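(* Let $d,n_1,\dots,n_d$ be positive integers. For each $r\in\{1,\dots,d\}$ let $T^r=(T^r_1,\dots,T^r_{n_r})$ be a commuting $n_r$-tuple of operators on $\mathbb{C}^2$ that is a row contraction, and assume that for $r\ne s$ every entry of $T^r$ commutes with every entry of $T^s$. Then the closed polyball $\overline{\mathbb{B}_{n_1}}\times\cdots\times\overline{\mathbb{B}_{n_d}}\subset\mathbb{C}^{n_1+\cdots+n_d}$ is a complete spectral set for the commuting tuple $T:=(T^1,\dots,T^d)$.
   Context: $\mathbb{B}_n$ denotes the open Euclidean unit ball of $\mathbb{C}^n$. A tuple $(A_1,\dots,A_n)$ of operators on $\mathbb{C}^2$ is a row contraction if the row operator $[A_1\ \cdots\ A_n]:(\mathbb{C}^2)^n\to\mathbb{C}^2$ has norm at most $1$. A compact set $K\subset\mathbb{C}^N$ is a complete spectral set for a commuting $N$-tuple of matrices $T$ if the (Taylor) joint spectrum satisfies $\sigma(T)\subset K$ and, for every positive integer $n$ and every $n\times n$-matrix-valued rational function $q$ on $K$ (entries are quotients of polynomials whose denominators do not vanish on $K$, so that $q$ is bounded on $K$ and $q(T)$ is defined), $\|q(T)\|\le\sup_{z\in K}\|q(z)\|$. For commuting matrices, $\sigma(T)$ is the set of joint eigenvalues. *)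

theory Defs
  imports "HOL-Analysis.Analysis" "HOL-Library.Poly_Mapping"
begin

text \<open>
  Points of the \<open>N\<close>-dimensional complex space are functions in \<open>I \<rightarrow>\<^sub>E UNIV\<close> for a finite index set
  \<open>I\<close> with \<open>N\<close> elements; \<open>N\<close>-tuples of operators on \<^typ>\<open>complex ^ 'n\<close> are functions from \<open>I\<close> to
  matrices, only the values on \<open>I\<close> being relevant. (On \<^typ>\<open>complex ^ 'n\<close> the library norm is the
  Euclidean one.)
\<close>

text \<open>
  Norm of the block operator with entries \<open>F i j :: 'a \<Rightarrow> 'b\<close>, from the Hilbert direct sum of copies
  of \<open>'a\<close> over \<open>J\<close> to that of copies of \<open>'b\<close> over \<open>I\<close> (\<open>I\<close>, \<open>J\<close> finite).
  It is not an \<^const>\<open>onorm\<close> because the index sets have to be sets rather than types.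
\<close>

definition block_norm ::
  "'i set \<Rightarrow> 'j set \<Rightarrow> ('i \<Rightarrow> 'j \<Rightarrow> 'a::real_normed_vector \<Rightarrow> 'b::real_normed_vector) \<Rightarrow> real"
  where "block_norm I J F =
    Sup {L2_set (\<lambda>i. norm (\<Sum>j\<in>J. F i j (x j))) I | x. L2_set (\<lambda>j. norm (x j)) J \<le> 1}"

definition row_contraction :: "'j set \<Rightarrow> ('j \<Rightarrow> complex ^ 'n ^ 'n) \<Rightarrow> bool"
  where "row_contraction J A \<longleftrightarrow> block_norm {()} J (\<lambda>_ j. (*v) (A j)) \<le> 1"

definition commuting_tuple :: "'v set \<Rightarrow> ('v \<Rightarrow> complex ^ 'n ^ 'n) \<Rightarrow> bool"
  where "commuting_tuple I T \<longleftrightarrow> (\<forall>u\<in>I. \<forall>v\<in>I. T u ** T v = T v ** T u)"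

text \<open>
  Complex polynomials in variables from \<open>'v\<close>: finitely supported maps from monomials
  (finitely supported exponent functions) to coefficients.
\<close>

type_synonym 'v cpoly = "('v \<Rightarrow>\<^sub>0 nat) \<Rightarrow>\<^sub>0 complex"

definition poly_in :: "'v set \<Rightarrow> 'v cpoly \<Rightarrow> bool"
  where "poly_in I p \<longleftrightarrow> (\<forall>m\<in>Poly_Mapping.keys p. Poly_Mapping.keys m \<subseteq> I)"

definition poly_eval :: "'v cpoly \<Rightarrow> ('v \<Rightarrow> complex) \<Rightarrow> complex"
  where "poly_eval p z =
    (\<Sum>m\<in>Poly_Mapping.keys p. Poly_Mapping.lookup p m *
       (\<Prod>v\<in>Poly_Mapping.keys m. z v ^ Poly_Mapping.lookup m v))"

definition mat_power :: "complex ^ 'n ^ 'n \<Rightarrow> nat \<Rightarrow> complex ^ 'n ^ 'n"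
  where "mat_power A k = (((**) A) ^^ k) (mat 1)"

text \<open>
  The product over the variables of a monomial is independent of the order, hence
  \<^const>\<open>Finite_Set.fold\<close> is meaningful, as soon as the matrices \<open>T v\<close> commute.
  Scalars are multiplied in as scalar matrices \<open>mat c\<close>, as \<open>*\<close> on matrices is entrywise.
\<close>

definition monom_mat :: "('v \<Rightarrow>\<^sub>0 nat) \<Rightarrow> ('v \<Rightarrow> complex ^ 'n ^ 'n) \<Rightarrow> complex ^ 'n ^ 'n"
  where "monom_mat m T =
    Finite_Set.fold (\<lambda>v B. mat_power (T v) (Poly_Mapping.lookup m v) ** B) (mat 1)
      (Poly_Mapping.keys m)"

definition poly_mat :: "'v cpoly \<Rightarrow> ('v \<Rightarrow> complex ^ 'n ^ 'n) \<Rightarrow> complex ^ 'n ^ 'n"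
  where "poly_mat p T =
    (\<Sum>m\<in>Poly_Mapping.keys p. mat (Poly_Mapping.lookup p m) ** monom_mat m T)"

definition joint_spectrum :: "'v set \<Rightarrow> ('v \<Rightarrow> complex ^ 'n ^ 'n) \<Rightarrow> ('v \<Rightarrow> complex) set"
  where "joint_spectrum I T =
    {l \<in> I \<rightarrow>\<^sub>E UNIV. \<exists>x. x \<noteq> 0 \<and> (\<forall>v\<in>I. T v *v x = l v *s x)}"

text \<open>
  A \<open>k \<times> k\<close> matrix-valued rational function is given by numerators \<open>p i j\<close> and denominators
  \<open>s i j\<close> for \<open>i, j < k\<close>. The compactness of \<open>K\<close> refers to the product topology on functions, which
  on \<open>I \<rightarrow>\<^sub>E UNIV\<close> is the usual topology of the \<open>N\<close>-dimensional space.
\<close>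

definition rational_on ::
  "'v set \<Rightarrow> ('v \<Rightarrow> complex) set \<Rightarrow> nat \<Rightarrow> (nat \<Rightarrow> nat \<Rightarrow> 'v cpoly) \<Rightarrow> (nat \<Rightarrow> nat \<Rightarrow> 'v cpoly) \<Rightarrow> bool"
  where "rational_on I K k p s \<longleftrightarrow>
    (\<forall>i<k. \<forall>j<k. poly_in I (p i j) \<and> poly_in I (s i j) \<and> (\<forall>z\<in>K. poly_eval (s i j) z \<noteq> 0))"

definition complete_spectral_set ::
  "'v set \<Rightarrow> ('v \<Rightarrow> complex) set \<Rightarrow> ('v \<Rightarrow> complex ^ 'n ^ 'n) \<Rightarrow> bool"
  where "complete_spectral_set I K T \<longleftrightarrow>
    commuting_tuple I T \<and> K \<subseteq> I \<rightarrow>\<^sub>E UNIV \<and> compact K \<and> joint_spectrum I T \<subseteq> K \<and>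
    (\<forall>k>0. \<forall>p s. rational_on I K k p s \<longrightarrow>
      block_norm {..<k} {..<k}
        (\<lambda>i j. (*v) (poly_mat (p i j) T ** matrix_inv (poly_mat (s i j) T)))
      \<le> (SUP z\<in>K. block_norm {..<k} {..<k}
            (\<lambda>i j. (*) (poly_eval (p i j) z / poly_eval (s i j) z))))"

text \<open>
  Coordinates of the product of \<open>d\<close> balls of dimensions \<open>n 1, \<dots>, n d\<close> are indexed by pairs
  \<open>(r, i)\<close>: the \<open>i\<close>-th coordinate of the \<open>r\<close>-th factor.
\<close>

definition polyball_index :: "nat \<Rightarrow> (nat \<Rightarrow> nat) \<Rightarrow> (nat \<times> nat) set"
  where "polyball_index d n = (SIGMA r:{1..d}. {1..n r})"

definition closed_polyball :: "nat \<Rightarrow> (nat \<Rightarrow> nat) \<Rightarrow> (nat \<times> nat \<Rightarrow> complex) set"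
  where "closed_polyball d n =
    {z \<in> polyball_index d n \<rightarrow>\<^sub>E UNIV. \<forall>r\<in>{1..d}. L2_set (\<lambda>i. cmod (z (r, i))) {1..n r} \<le> 1}"

end

theory Submission
  imports Defs "HOL-Complex_Analysis.Cauchy_Integral_Formula"
begin

text \<open>
  Commuting \<open>2 \<times> 2\<close> matrices are affine functions of one matrix, so the tuple is a limit of strict row
  contractions with two independent joint left eigenvectors \<open>x\<close>, \<open>y\<close> and joint eigenvalues \<open>a\<close>, \<open>m\<close>.
  If \<open>\<gamma>\<close> is the cosine of the angle between \<open>x\<close> and \<open>y\<close>, then row contractivity of a block says that
  \<open>\<gamma>\<^sup>2 |1 - \<langle>m, a\<rangle>|\<^sup>2 \<le> (1 - |a|\<^sup>2) (1 - |m|\<^sup>2)\<close>, which is exactly the condition for an analytic disc in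
  that ball to pass through \<open>a\<close> at \<open>0\<close> and through \<open>m\<close> at \<open>s = sqrt (1 - \<gamma>\<^sup>2)\<close>. As \<open>s\<close> is the same for
  all blocks, there is such a disc in the polyball. Along it the rational function becomes a function
  of one variable, for which the inequality is the two-point case of the matrix Pick theorem: \<open>x\<close>, \<open>y\<close>
  have the Gram matrix of the normalized Szego kernels at \<open>0\<close> and \<open>s\<close>.
\<close>

section \<open>Norms of block operators\<close>

text \<open>In terms of the pseudohyperbolic distance rho of the ball, given by 1 - rho^2 = (1 -
  |a|^2) (1 - |m|^2) / |1 - <m, a>|^2, the inequality for a block says rho(a, m) <= s. Dimension two
  is essential to this argument: two eigenvectors form a single angle, and this angle bounds the
  distance in every block by the same s, so the discs of the blocks can be run with one parameter.
  Left eigenvectors occur because contractivity of a row is a bound on its adjoint column, which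
  sends a row vector z to the vectors z S_v. Strictness puts a and m into the open balls, so that 1
  - <m, a> is nonzero; independence of the eigenvectors gives s > 0. The return to the limit needs
  invertible denominators at T itself. For each approximant the determinant of a denominator is a
  product of two of its values on the polyball, hence bounded away from zero by compactness.\<close>

lemma block_norm_least:
  fixes F :: "'i \<Rightarrow> 'j \<Rightarrow> 'a::real_normed_vector \<Rightarrow> 'b::real_normed_vector"
  assumes "\<And>x. L2_set (\<lambda>j. norm (x j)) J \<le> 1 \<Longrightarrow> L2_set (\<lambda>i. norm (\<Sum>j\<in>J. F i j (x j))) I \<le> B"
  shows "block_norm I J F \<le> B"
  unfolding block_norm_def
proof (rule cSup_least)
  have "L2_set (\<lambda>j. norm (0::'a)) J \<le> 1"
    by (simp add: L2_set_def)
  then have "L2_set (\<lambda>i. norm (\<Sum>j\<in>J. F i j 0)) I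
      \<in> {L2_set (\<lambda>i. norm (\<Sum>j\<in>J. F i j (x j))) I |x. L2_set (\<lambda>j. norm (x j)) J \<le> 1}"
    by (intro CollectI exI[of _ "\<lambda>_. 0"]) auto
  then show "{L2_set (\<lambda>i. norm (\<Sum>j\<in>J. F i j (x j))) I |x. L2_set (\<lambda>j. norm (x j)) J \<le> 1} \<noteq> {}"
    by blast
qed (use assms in auto)

text \<open>A crude bound: it makes the set in \<open>block_norm\<close> bounded above, so that its
  real \<open>Sup\<close> is a genuine supremum, and it depends on the entries one by one.\<close>

lemma L2_block_le_sum_onorm:
  assumes "finite I" "finite J" "\<And>i j. i \<in> I \<Longrightarrow> j \<in> J \<Longrightarrow> bounded_linear (F i j)"
    and x: "L2_set (\<lambda>j. norm (x j)) J \<le> 1"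
  shows "L2_set (\<lambda>i. norm (\<Sum>j\<in>J. F i j (x j))) I \<le> (\<Sum>i\<in>I. \<Sum>j\<in>J. onorm (F i j))"
proof -
  have 1: "norm (x j) \<le> 1" if "j \<in> J" for j
    using member_le_L2_set[OF \<open>finite J\<close> that, of "\<lambda>j. norm (x j)"] x by linarith
  have 2: "norm (F i j (x j)) \<le> onorm (F i j)" if "i \<in> I" "j \<in> J" for i j
  proof -
    have "norm (F i j (x j)) \<le> onorm (F i j) * norm (x j)"
      using assms(3) that onorm by blast
    also have "\<dots> \<le> onorm (F i j) * 1"
      using 1[OF that(2)] onorm_pos_le[OF assms(3)[OF that]] by (intro mult_left_mono)
    finally show ?thesis by simp
  qed
  have "L2_set (\<lambda>i. norm (\<Sum>j\<in>J. F i j (x j))) I \<le> (\<Sum>i\<in>I. norm (\<Sum>j\<in>J. F i j (x j)))"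
    by (rule L2_set_le_sum) simp
  also have "\<dots> \<le> (\<Sum>i\<in>I. \<Sum>j\<in>J. onorm (F i j))"
    by (intro sum_mono order_trans[OF norm_sum] 2)
  finally show ?thesis .
qed

lemma block_norm_apply:
  assumes "finite I" "finite J" "\<And>i j. i \<in> I \<Longrightarrow> j \<in> J \<Longrightarrow> bounded_linear (F i j)"
  shows "L2_set (\<lambda>i. norm (\<Sum>j\<in>J. F i j (x j))) I \<le> block_norm I J F * L2_set (\<lambda>j. norm (x j)) J"
proof (cases "L2_set (\<lambda>j. norm (x j)) J = 0")
  case True
  then have "x j = 0" if "j \<in> J" for j
    using that assms(2) by (simp add: L2_set_eq_0_iff)
  then have "norm (\<Sum>j\<in>J. F i j (x j)) = 0" if "i \<in> I" for i
    using that assms(3) by (simp add: linear_simps(3))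
  then have "L2_set (\<lambda>i. norm (\<Sum>j\<in>J. F i j (x j))) I = 0"
    by (intro L2_set_0') auto
  then show ?thesis using True by simp
next
  case False
  define N where "N = L2_set (\<lambda>j. norm (x j)) J"
  have N: "N > 0" using False unfolding N_def by (simp add: less_le)
  define y where "y j = (1/N) *\<^sub>R x j" for j
  have "L2_set (\<lambda>j. norm (y j)) J = L2_set (\<lambda>j. (1/N) * norm (x j)) J"
    unfolding y_def using N by simp
  also have "\<dots> = (1/N) * N"
    using N unfolding N_def by (subst L2_set_right_distrib) auto
  finally have "L2_set (\<lambda>j. norm (y j)) J = (1/N) * N" .
  then have y: "L2_set (\<lambda>j. norm (y j)) J \<le> 1" using N by simp
  have bdd: "bdd_above {L2_set (\<lambda>i. norm (\<Sum>j\<in>J. F i j (x j))) I |x. L2_set (\<lambda>j. norm (x j)) J \<le> 1}"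
    using L2_block_le_sum_onorm[of I J F] assms by (intro bdd_aboveI) blast
  have "L2_set (\<lambda>i. norm (\<Sum>j\<in>J. F i j (y j))) I \<le> block_norm I J F"
    unfolding block_norm_def by (rule cSup_upper[OF _ bdd]) (use y in blast)
  moreover have "L2_set (\<lambda>i. norm (\<Sum>j\<in>J. F i j (y j))) I
      = L2_set (\<lambda>i. (1/N) * norm (\<Sum>j\<in>J. F i j (x j))) I"
  proof (rule L2_set_cong)
    fix i assume i: "i \<in> I"
    have "(\<Sum>j\<in>J. F i j (y j)) = (\<Sum>j\<in>J. (1/N) *\<^sub>R F i j (x j))"
      unfolding y_def using assms(3)[OF i] by (intro sum.cong refl) (simp add: linear_simps(5))
    also have "\<dots> = (1/N) *\<^sub>R (\<Sum>j\<in>J. F i j (x j))"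
      by (simp add: scaleR_sum_right)
    finally show "norm (\<Sum>j\<in>J. F i j (y j)) = (1/N) * norm (\<Sum>j\<in>J. F i j (x j))"
      using N by simp
  qed simp
  moreover have "\<dots> = (1/N) * L2_set (\<lambda>i. norm (\<Sum>j\<in>J. F i j (x j))) I"
    using N by (intro L2_set_right_distrib[symmetric]) auto
  ultimately have "(1/N) * L2_set (\<lambda>i. norm (\<Sum>j\<in>J. F i j (x j))) I \<le> block_norm I J F"
    by metis
  then show ?thesis
    using N unfolding N_def[symmetric] by (simp add: field_simps)
qed

lemma row_contraction_apply:
  fixes A :: "'j \<Rightarrow> complex ^ 'n ^ 'n"
  assumes "finite J" "row_contraction J A"
  shows "norm (\<Sum>j\<in>J. A j *v x j) \<le> L2_set (\<lambda>j. norm (x j)) J"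
proof -
  have "L2_set (\<lambda>i. norm (\<Sum>j\<in>J. A j *v x j)) {()}
      \<le> block_norm {()} J (\<lambda>_ j. (*v) (A j)) * L2_set (\<lambda>j. norm (x j)) J"
    using assms(1) by (intro block_norm_apply) auto
  also have "\<dots> \<le> 1 * L2_set (\<lambda>j. norm (x j)) J"
    using assms(2) unfolding row_contraction_def by (intro mult_right_mono) auto
  finally show ?thesis by (simp add: L2_set_def)
qed

section \<open>Polynomials in commuting matrices\<close>

lemma mat_power_0 [simp]: "mat_power A 0 = mat 1"
  by (simp add: mat_power_def)

lemma mat_power_Suc [simp]: "mat_power A (Suc k) = A ** mat_power A k"
  by (simp add: mat_power_def)

lemma mat_power_commute:
  assumes "A ** B = B ** A"
  shows "A ** mat_power B k = mat_power B k ** A"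
proof (induction k)
  case (Suc k)
  have "A ** (B ** mat_power B k) = B ** (A ** mat_power B k)"
    using assms by (metis matrix_mul_assoc)
  then show ?case using Suc by (simp add: matrix_mul_assoc)
qed simp

lemma mat_powers_commute:
  assumes "A ** B = B ** A"
  shows "mat_power A l ** mat_power B k = mat_power B k ** mat_power A l"
  by (rule mat_power_commute) (rule mat_power_commute[OF assms[symmetric], symmetric])

text \<open>\<open>Finite_Set.fold\<close> unfolds only for commuting steps. The steps commute just
  for variables in \<open>I\<close>, hence the relative locale and the condition that all variables
  lie in \<open>I\<close>.\<close>

lemma fold_mat_power_insert:
  assumes "commuting_tuple I T" "insert v J \<subseteq> I" "finite J" "v \<notin> J"
  shows "Finite_Set.fold (\<lambda>v B. mat_power (T v) (e v) ** B) (mat 1) (insert v J)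
    = mat_power (T v) (e v) ** Finite_Set.fold (\<lambda>v B. mat_power (T v) (e v) ** B) (mat 1) J"
proof -
  interpret comp_fun_commute_on I "\<lambda>v B. mat_power (T v) (e v) ** B"
  proof
    fix x y assume "x \<in> I" "y \<in> I"
    then have "T x ** T y = T y ** T x"
      using assms(1) by (auto simp: commuting_tuple_def)
    then show "(**) (mat_power (T y) (e y)) \<circ> (**) (mat_power (T x) (e x)) =
           (**) (mat_power (T x) (e x)) \<circ> (**) (mat_power (T y) (e y))"
      using mat_powers_commute[of "T x" "T y" "e x" "e y"] by (simp add: fun_eq_iff matrix_mul_assoc)
  qed
  show ?thesis using assms by (intro fold_insert) auto
qed

section \<open>Polynomials of a tuple on its joint left eigenvectors\<close>

lemma left_eigen_mat_power:
  assumes "w v* A = a *s w"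
  shows "w v* mat_power A k = a ^ k *s w"
proof (induction k)
  case (Suc k)
  have "w v* (A ** mat_power A k) = (a *s w) v* mat_power A k"
    using assms by (metis vector_matrix_mul_assoc)
  then show ?case using Suc
    by (simp add: scalar_vector_matrix_assoc vector_smult_assoc)
qed simp

lemma left_eigen_fold:
  assumes "commuting_tuple I T" "J \<subseteq> I" "finite J" "\<And>v. v \<in> I \<Longrightarrow> w v* T v = z v *s w"
  shows "w v* Finite_Set.fold (\<lambda>v B. mat_power (T v) (e v) ** B) (mat 1) J = (\<Prod>v\<in>J. z v ^ e v) *s w"
  using assms(3,2)
proof (induction J)
  case (insert v J)
  have 1: "w v* mat_power (T v) (e v) = z v ^ e v *s w"
    using assms(4) insert.prems by (intro left_eigen_mat_power) auto
  show ?case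
    using insert fold_mat_power_insert[OF assms(1) insert.prems insert.hyps, of e]
    by (simp add: vector_matrix_mul_assoc[symmetric] 1 scalar_vector_matrix_assoc vector_smult_assoc)
qed simp

lemma vector_matrix_mat [simp]: "w v* mat c = c *s w" for c :: "'a::comm_semiring_1"
  by (simp add: vec_eq_iff vector_matrix_mult_def mat_def if_distrib if_distribR cong: if_cong) (simp add: mult.commute)

lemma vector_matrix_sum: "w v* (\<Sum>m\<in>S. A m) = (\<Sum>m\<in>S. w v* A m)"
  by (induction S rule: infinite_finite_induct) (auto simp: vector_matrix_mult_add_rdistrib)

text \<open>Left multiplication by a product is done factor by factor, so a joint left eigenvector
  turns the functional calculus into evaluation at the point of its eigenvalues.\<close>

lemma left_eigen_poly_mat:
  assumes "commuting_tuple I T" "poly_in I f" "\<And>v. v \<in> I \<Longrightarrow> w v* T v = z v *s w"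
  shows "w v* poly_mat f T = poly_eval f z *s w"
proof -
  have "w v* (mat c ** monom_mat m T) = (c * (\<Prod>v\<in>Poly_Mapping.keys m. z v ^ Poly_Mapping.lookup m v)) *s w"
    if "m \<in> Poly_Mapping.keys f" for m c
  proof -
    have "Poly_Mapping.keys m \<subseteq> I" using assms(2) that by (auto simp: poly_in_def)
    then show ?thesis
      using left_eigen_fold[OF assms(1) _ _ assms(3), of "Poly_Mapping.keys m" "Poly_Mapping.lookup m"]
      by (simp add: monom_mat_def vector_matrix_mul_assoc[symmetric] scalar_vector_matrix_assoc vector_smult_assoc)
  qed
  then show ?thesis
    by (simp add: poly_mat_def poly_eval_def vector_matrix_sum vec_eq_iff sum_distrib_right)
qed

section \<open>Continuity of polynomials in the commuting tuple\<close>

lemma tendsto_matrix_mul: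
  fixes A B :: "'x \<Rightarrow> complex ^ 'n ^ 'n"
  assumes "(A \<longlongrightarrow> a) F" "(B \<longlongrightarrow> b) F"
  shows "((\<lambda>x. A x ** B x) \<longlongrightarrow> a ** b) F"
  unfolding matrix_matrix_mult_def by (intro tendsto_intros assms)

lemma tendsto_mat_power:
  fixes A :: "'x \<Rightarrow> complex ^ 'n ^ 'n"
  assumes "(A \<longlongrightarrow> a) F"
  shows "((\<lambda>x. mat_power (A x) k) \<longlongrightarrow> mat_power a k) F"
  by (induction k) (auto intro!: tendsto_matrix_mul assms)

lemma tendsto_fold_mat_power:
  fixes T :: "'v \<Rightarrow> complex ^ 'n ^ 'n"
  assumes "\<And>x. commuting_tuple I (S x)" "commuting_tuple I T"
    and "\<And>v. v \<in> I \<Longrightarrow> ((\<lambda>x. S x v) \<longlongrightarrow> T v) F" "finite J" "J \<subseteq> I"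
  shows "((\<lambda>x. Finite_Set.fold (\<lambda>v B. mat_power (S x v) (e v) ** B) (mat 1) J)
    \<longlongrightarrow> Finite_Set.fold (\<lambda>v B. mat_power (T v) (e v) ** B) (mat 1) J) F"
  using assms(4,5)
proof (induction J)
  case (insert v J)
  note i = fold_mat_power_insert[OF _ insert.prems insert.hyps]
  show ?case
    unfolding i[OF assms(1)] i[OF assms(2)]
    using insert assms(3) by (intro tendsto_matrix_mul tendsto_mat_power) auto
qed simp

lemma tendsto_poly_mat:
  fixes T :: "'v \<Rightarrow> complex ^ 'n ^ 'n"
  assumes "\<And>x. commuting_tuple I (S x)" "commuting_tuple I T"
    and "\<And>v. v \<in> I \<Longrightarrow> ((\<lambda>x. S x v) \<longlongrightarrow> T v) F" "poly_in I f"
  shows "((\<lambda>x. poly_mat f (S x)) \<longlongrightarrow> poly_mat f T) F"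
  unfolding poly_mat_def monom_mat_def
  using assms(4) by (intro tendsto_sum tendsto_matrix_mul tendsto_const
      tendsto_fold_mat_power[OF assms(1-3)]) (auto simp: poly_in_def)

section \<open>Two by two matrices\<close>

lemma matrix_mul_2:
  fixes A B :: "complex ^ 2 ^ 2"
  shows "(A ** B) $ i $ j = A $ i $ 1 * B $ 1 $ j + A $ i $ 2 * B $ 2 $ j"
  by (simp add: matrix_matrix_mult_def sum_2)

lemma matrix_eq_2:
  fixes A B :: "complex ^ 2 ^ 2"
  shows "A = B \<longleftrightarrow> A$1$1 = B$1$1 \<and> A$1$2 = B$1$2 \<and> A$2$1 = B$2$1 \<and> A$2$2 = B$2$2"
  unfolding vec_eq_iff forall_2 by blast

lemma vector_matrix_2:
  fixes A :: "complex ^ 2 ^ 2"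
  shows "(w v* A) $ j = w $ 1 * A $ 1 $ j + w $ 2 * A $ 2 $ j"
  by (simp add: vector_matrix_mult_def sum_2)

lemma mat_2 [simp]:
  "(mat c :: complex ^ 2 ^ 2) $ 1 $ 1 = c" "(mat c :: complex ^ 2 ^ 2) $ 1 $ 2 = 0"
  "(mat c :: complex ^ 2 ^ 2) $ 2 $ 1 = 0" "(mat c :: complex ^ 2 ^ 2) $ 2 $ 2 = c"
  by (simp_all add: mat_def)

text \<open>The centralizer of a nonscalar 2 x 2 matrix is spanned by the identity and that matrix.
  Any nonscalar member of the tuple can serve as \<open>A\<close>; if there is none,
  \<open>A\<close> is zero.\<close>

lemma commuting_tuple_2_span:
  fixes T :: "'v \<Rightarrow> complex ^ 2 ^ 2"
  assumes "commuting_tuple I T"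
  obtains A a b where "\<And>v. v \<in> I \<Longrightarrow> T v = mat (a v) + mat (b v) ** A"
proof (cases "\<exists>w\<in>I. \<not> (\<exists>c. T w = mat c)")
  case True
  then obtain w where w: "w \<in> I" "\<And>c. T w \<noteq> mat c" by blast
  have "\<exists>a b. T v = mat a + mat b ** T w" if "v \<in> I" for v
  proof -
    have comm: "T v ** T w = T w ** T v" using assms that w by (auto simp: commuting_tuple_def)
    \<comment> \<open>Modulo scalars a matrix is the triple of its two off-diagonal entries and the
      difference of its diagonal entries. \<open>b\<close> is the ratio of the two triples, read off
      at a nonzero coordinate of the second.\<close>
    define b where "b = (if T w $ 1 $ 2 \<noteq> 0 then T v $ 1 $ 2 / T w $ 1 $ 2
      else if T w $ 2 $ 1 \<noteq> 0 then T v $ 2 $ 1 / T w $ 2 $ 1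
      else (T v $ 1 $ 1 - T v $ 2 $ 2) / (T w $ 1 $ 1 - T w $ 2 $ 2))"
    have nz: "T w $ 1 $ 2 \<noteq> 0 \<or> T w $ 2 $ 1 \<noteq> 0 \<or> T w $ 1 $ 1 - T w $ 2 $ 2 \<noteq> 0"
      using w(2)[of "T w $ 1 $ 1"] by (auto simp: matrix_eq_2)
    \<comment> \<open>Commutation says that the cross product of the two triples vanishes, so they
      are proportional.\<close>
    have "T v $ 1 $ 2 * T w $ 2 $ 1 = T w $ 1 $ 2 * T v $ 2 $ 1"
      "(T w $ 1 $ 1 - T w $ 2 $ 2) * T v $ 1 $ 2 = T w $ 1 $ 2 * (T v $ 1 $ 1 - T v $ 2 $ 2)"
      "(T w $ 1 $ 1 - T w $ 2 $ 2) * T v $ 2 $ 1 = T w $ 2 $ 1 * (T v $ 1 $ 1 - T v $ 2 $ 2)"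
      using comm unfolding matrix_eq_2 matrix_mul_2 by algebra+
    then have "T v $ 1 $ 2 = b * T w $ 1 $ 2" "T v $ 2 $ 1 = b * T w $ 2 $ 1"
      "T v $ 1 $ 1 - T v $ 2 $ 2 = b * (T w $ 1 $ 1 - T w $ 2 $ 2)"
      using nz unfolding b_def by (auto simp: field_simps)
    then have "T v = mat (T v $ 1 $ 1 - b * T w $ 1 $ 1) + mat b ** T w"
      by (auto simp: matrix_eq_2 matrix_mul_2 algebra_simps)
    then show ?thesis by blast
  qed
  then show ?thesis using that by metis
next
  case False
  then have "\<exists>c. T v = mat c + mat 0 ** mat 0" if "v \<in> I" for v
    using that by (auto simp: matrix_eq_2 matrix_mul_2)
  then obtain a where "\<And>v. v \<in> I \<Longrightarrow> T v = mat (a v) + mat 0 ** mat 0" by metis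
  then show ?thesis by (rule that)
qed

section \<open>Inverses of matrices and their continuity\<close>

lemma matrix_inv_eqI:
  fixes A B :: "complex ^ 'n ^ 'n"
  assumes "A ** B = mat 1"
  shows "matrix_inv A = B"
proof -
  have "B ** A = mat 1" using assms by (simp add: matrix_left_right_inverse)
  then have "A ** matrix_inv A = mat 1 \<and> matrix_inv A ** A = mat 1"
    unfolding matrix_inv_def using assms by (rule_tac someI[of _ B]) auto
  then have "B = B ** (A ** matrix_inv A)" by simp
  then show ?thesis using \<open>B ** A = mat 1\<close> by (simp add: matrix_mul_assoc)
qed

lemma matrix_inv_2:
  fixes A :: "complex ^ 2 ^ 2"
  assumes "det A \<noteq> 0"
  shows "matrix_inv A = vector [vector [A$2$2 / det A, - A$1$2 / det A], vector [- A$2$1 / det A, A$1$1 / det A]]"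
proof (rule matrix_inv_eqI, unfold matrix_eq_2 matrix_mul_2 vector_2 mat_2, intro conjI)
qed (use assms in \<open>simp_all add: field_simps, simp_all add: det_2 algebra_simps\<close>)

lemma tendsto_matrix_inv_2:
  fixes A :: "'x \<Rightarrow> complex ^ 2 ^ 2"
  assumes "(A \<longlongrightarrow> a) F" "det a \<noteq> 0"
  shows "((\<lambda>x. matrix_inv (A x)) \<longlongrightarrow> matrix_inv a) F"
proof -
  have d: "((\<lambda>x. det (A x)) \<longlongrightarrow> det a) F"
    unfolding det_2 by (intro tendsto_intros assms)
  have ev: "eventually (\<lambda>x. det (A x) \<noteq> 0) F"
    using tendsto_imp_eventually_ne[OF d assms(2)] .
  let ?inv = "\<lambda>A::complex ^ 2 ^ 2. vector [vector [A$2$2 / det A, - A$1$2 / det A],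
      vector [- A$2$1 / det A, A$1$1 / det A]] :: complex ^ 2 ^ 2"
  have "((\<lambda>x. ?inv (A x)) \<longlongrightarrow> ?inv a) F"
  proof -
    have "\<forall>i j. ((\<lambda>x. ?inv (A x) $ i $ j) \<longlongrightarrow> ?inv a $ i $ j) F"
      unfolding forall_2 vector_2 by (intro conjI tendsto_intros assms d)
    then show ?thesis by (intro vec_tendstoI) blast
  qed
  then show ?thesis
    unfolding matrix_inv_2[OF assms(2)]
    by (rule Lim_transform_eventually) (use ev in \<open>eventually_elim, simp add: matrix_inv_2\<close>)
qed

section \<open>Left eigenvectors, inverses and determinants\<close>

lemma left_eigen_matrix_inv:
  fixes A :: "complex ^ 'n ^ 'n"
  assumes "w v* A = a *s w" "a \<noteq> 0" "det A \<noteq> 0"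
  shows "w v* matrix_inv A = (1 / a) *s w"
proof -
  have "invertible A" using assms(3) by (simp add: invertible_det_nz)
  then have inv: "A ** matrix_inv A = mat 1"
    using matrix_inv_eqI by (metis invertible_def)
  have "w = (a *s w) v* matrix_inv A"
    using assms(1) inv by (metis vector_matrix_mul_assoc vector_matrix_mul_rid)
  then have "(1 / a) *s w = (1 / a) *s (a *s (w v* matrix_inv A))"
    by (simp add: scalar_vector_matrix_assoc)
  then show ?thesis using assms(2) by (simp add: vector_smult_assoc)
qed

text \<open>The invertible matrix with rows \<open>p\<close> and \<open>r\<close> conjugates
  \<open>A\<close> to the diagonal matrix of \<open>a\<close> and \<open>b\<close>.\<close>

lemma det_left_eigen_2:
  fixes A :: "complex ^ 2 ^ 2"
  assumes "p v* A = a *s p" "r v* A = b *s r" "p $ 1 * r $ 2 \<noteq> p $ 2 * r $ 1"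
  shows "det A = a * b"
proof -
  define R :: "complex ^ 2 ^ 2" where "R = vector [p, r]"
  have "R ** A = vector [a *s p, b *s r]"
    using assms(1,2) by (auto simp: vec_eq_iff forall_2 R_def matrix_mul_2 vector_matrix_2)
  then have "det R * det A = a * b * det R"
    by (simp add: det_mul[symmetric]) (simp add: det_2 R_def algebra_simps)
  moreover have "det R \<noteq> 0" using assms(3) by (simp add: det_2 R_def)
  ultimately show ?thesis by simp
qed

lemma left_eigenvector_exists:
  fixes A :: "complex ^ 2 ^ 2"
  assumes "det (A - mat a) = 0"
  obtains w where "w \<noteq> 0" "w v* A = a *s w"
proof -
  have "det (transpose (A - mat a)) = 0" using assms by simp
  then obtain w where w: "w \<noteq> 0" "transpose (A - mat a) *v w = 0"
    by (metis invertible_det_nz invertible_left_inverse matrix_left_invertible_ker)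
  then have "w v* A = w v* mat a" by (simp add: vector_matrix_mult_diff_rdistrib)
  then show ?thesis using that w(1) by simp
qed

text \<open>The hypothesis is that the discriminant of the characteristic polynomial is nonzero, so
  the eigenvalues differ; the last conclusion is linear independence.\<close>

lemma distinct_left_eigenvectors_2:
  fixes A :: "complex ^ 2 ^ 2"
  assumes "(A$1$1 - A$2$2)^2 + 4 * A$1$2 * A$2$1 \<noteq> 0"
  obtains p r \<alpha> \<beta> where "p v* A = \<alpha> *s p" "r v* A = \<beta> *s r" "p $ 1 * r $ 2 \<noteq> p $ 2 * r $ 1"
proof -
  define D where "D = csqrt ((A$1$1 - A$2$2)^2 + 4 * A$1$2 * A$2$1)"
  have D2: "D^2 = (A$1$1 - A$2$2)^2 + 4 * A$1$2 * A$2$1" by (simp add: D_def)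
  have D0: "D \<noteq> 0" using assms D2 by auto
  define \<alpha> \<beta> where "\<alpha> = (A$1$1 + A$2$2 + D) / 2" and "\<beta> = (A$1$1 + A$2$2 - D) / 2"
  have "4 * det (A - mat \<alpha>) = 0" "4 * det (A - mat \<beta>) = 0"
    using D2 by (simp_all add: det_2 \<alpha>_def \<beta>_def field_simps power2_eq_square)
  then have "det (A - mat \<alpha>) = 0" "det (A - mat \<beta>) = 0" by simp_all
  then obtain p r where p: "p \<noteq> 0" "p v* A = \<alpha> *s p" and r: "r \<noteq> 0" "r v* A = \<beta> *s r"
    by (metis left_eigenvector_exists)
  have ne: "\<alpha> \<noteq> \<beta>" using D0 by (simp add: \<alpha>_def \<beta>_def)
  have "p $ 1 * r $ 2 \<noteq> p $ 2 * r $ 1"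
  proof
    assume *: "p $ 1 * r $ 2 = p $ 2 * r $ 1"
    obtain c where c: "r = c *s p"
    proof (cases "p $ 1 = 0")
      case True
      then have "p $ 2 \<noteq> 0" "r $ 1 = 0" using p(1) * by (auto simp: vec_eq_iff forall_2)
      then show ?thesis using that[of "r $ 2 / p $ 2"] True by (auto simp: vec_eq_iff forall_2)
    next
      case False
      then show ?thesis using that[of "r $ 1 / p $ 1"] * by (auto simp: vec_eq_iff forall_2 field_simps)
    qed
    then have c0: "c \<noteq> 0" using r(1) by auto
    obtain i where i: "p $ i \<noteq> 0" using p(1) by (auto simp: vec_eq_iff)
    have "\<beta> *s (c *s p) = c *s (\<alpha> *s p)"
      using r(2) p(2) c by (metis scalar_vector_matrix_assoc)
    then have "\<beta> * (c * p $ i) = c * (\<alpha> * p $ i)"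
      by (metis vector_smult_component)
    then show False using ne c0 i by simp
  qed
  then show ?thesis using that p r by blast
qed

section \<open>A two-point Pick inequality on the disc\<close>

text \<open>On the unit circle the factor \<open>e t / (e t - a)\<close> is the conjugate of the
  Szego kernel at \<open>a\<close>; this is its reproducing property.\<close>

lemma has_integral_circle_Cauchy:
  assumes "continuous_on (cball 0 1) G" "G holomorphic_on ball 0 1" "cmod a < 1"
  defines "e \<equiv> \<lambda>t::real. exp (2 * of_real pi * \<i> * of_real t)"
  shows "((\<lambda>t. G (e t) * (e t / (e t - a))) has_integral G a) {0..1}"
proof -
  have "((\<lambda>u. G u / (u - a)) has_contour_integral 2 * of_real pi * \<i> * G a) (circlepath 0 1)"
    using assms by (intro Cauchy_integral_circlepath) auto
  moreover have "(\<lambda>t. G (circlepath 0 1 t) / (circlepath 0 1 t - a) * vector_derivative (circlepath 0 1) (at t))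
      = (\<lambda>t. 2 * of_real pi * \<i> * (G (e t) * (e t / (e t - a))))"
    unfolding vector_derivative_circlepath by (simp add: circlepath e_def mult_ac)
  ultimately have "((\<lambda>t. 2 * of_real pi * \<i> * (G (e t) * (e t / (e t - a)))) has_integral
      2 * of_real pi * \<i> * G a) {0..1}"
    unfolding has_contour_integral by simp
  then have "((\<lambda>t. (1 / (2 * of_real pi * \<i>)) * (2 * of_real pi * \<i> * (G (e t) * (e t / (e t - a)))))
      has_integral (1 / (2 * of_real pi * \<i>)) * (2 * of_real pi * \<i> * G a)) {0..1}"
    by (rule has_integral_mult_right)
  then show ?thesis by simp
qed

text \<open>
  The squared norm of \<open>u x + v y\<close> for unit vectors \<open>x\<close>, \<open>y\<close> with inner product \<open>\<kappa>\<close>.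
\<close>

definition gram_form :: "real \<Rightarrow> complex \<Rightarrow> complex \<Rightarrow> real"
  where "gram_form \<kappa> u v = (cmod u)\<^sup>2 + (cmod v)\<^sup>2 + 2 * \<kappa> * Re (u * cnj v)"

text \<open>The Szego kernel at \<open>s\<close> has squared norm 1 / (1 - s^2) and inner product 1
  with the kernel at 0. So \<open>\<kappa>\<close> times it is a unit vector whose inner product
  with the kernel at 0 is \<open>\<kappa>\<close>, and \<open>gram_form \<kappa>\<close> is the
  squared norm on the span of both. Pairing the multiple by \<open>F\<close> of one such combination
  with the combination built from \<open>u'\<close> and \<open>v'\<close> returns the squared norm
  of the latter, because pairing only sees values at 0 and \<open>s\<close>.\<close>

lemma two_point_Pick:
  fixes F :: "'i \<Rightarrow> 'i \<Rightarrow> complex \<Rightarrow> complex" and s \<kappa> M :: real and u v :: "'i \<Rightarrow> complex"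
  assumes X: "finite X"
    and cont: "\<And>i j. i \<in> X \<Longrightarrow> j \<in> X \<Longrightarrow> continuous_on (cball 0 1) (F i j)"
    and hol: "\<And>i j. i \<in> X \<Longrightarrow> j \<in> X \<Longrightarrow> F i j holomorphic_on ball 0 1"
    and bound: "\<And>z \<phi> \<psi>. cmod z \<le> 1 \<Longrightarrow> cmod (\<Sum>i\<in>X. \<phi> i * (\<Sum>j\<in>X. F i j z * \<psi> j))
      \<le> M * (L2_set (\<lambda>i. cmod (\<phi> i)) X * L2_set (\<lambda>j. cmod (\<psi> j)) X)"
    and s: "0 \<le> s" "s < 1" and \<kappa>: "\<kappa>\<^sup>2 = 1 - s\<^sup>2"
  defines "u' \<equiv> \<lambda>j. \<Sum>i\<in>X. F i j 0 * u i" and "v' \<equiv> \<lambda>j. \<Sum>i\<in>X. F i j (of_real s) * v i"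
  shows "(\<Sum>j\<in>X. gram_form \<kappa> (u' j) (v' j)) \<le> M\<^sup>2 * (\<Sum>i\<in>X. gram_form \<kappa> (u i) (v i))"
proof -
  define e where "e t = exp (2 * of_real pi * \<i> * of_real t)" for t :: real
  have ne: "cmod (e t) = 1" for t by (simp add: e_def)
  have e0: "e t \<noteq> 0" for t using ne[of t] by auto
  have es: "e t \<noteq> of_real s" for t using ne[of t] s by (metis abs_of_nonneg less_irrefl norm_of_real)
  \<comment> \<open>On the circle \<open>\<phi> x y\<close> is the conjugate of a combination of Szego kernels at \<open>0\<close> and \<open>s\<close>, and
    \<open>\<theta> x y\<close> is the holomorphic extension of its conjugate. Pairing with \<open>\<phi>\<close> evaluates holomorphic
    functions at \<open>0\<close> and \<open>s\<close>.\<close>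
  define \<phi> where "\<phi> x y t = x + y * of_real \<kappa> * (e t / (e t - of_real s))" for x y t
  define \<theta> where "\<theta> x y z = cnj x + cnj y * of_real \<kappa> / (1 - of_real s * z)" for x y z
  have sz: "1 - of_real s * z \<noteq> 0" if "cmod z \<le> 1" for z
  proof
    assume "1 - of_real s * z = 0"
    then have "cmod (of_real s * z) = 1" by (metis eq_iff_diff_eq_0 norm_one)
    moreover have "s * cmod z \<le> s * 1" using that s by (intro mult_left_mono) auto
    ultimately show False using s by (simp add: norm_mult)
  qed
  have \<theta>\<phi>: "\<theta> x y (e t) = cnj (\<phi> x y t)" for x y t
  proof -
    have "e t * cnj (e t) = 1" using ne[of t] by (simp add: complex_norm_square[symmetric])
    then have *: "cnj (e t / (e t - of_real s)) = 1 / (1 - of_real s * e t)"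
      using e0[of t] es[of t] sz[of "e t"] ne[of t]
      by (simp add: divide_simps) (auto simp: algebra_simps)
    have "\<theta> x y (e t) = cnj x + cnj y * of_real \<kappa> * (1 / (1 - of_real s * e t))"
      by (simp add: \<theta>_def)
    also have "\<dots> = cnj (\<phi> x y t)"
      unfolding *[symmetric] \<phi>_def by simp
    finally show ?thesis .
  qed
  have \<theta>hol: "\<theta> x y holomorphic_on cball 0 1" for x y
    unfolding \<theta>_def using sz by (intro holomorphic_intros) auto
  have int: "((\<lambda>t. G (e t) * \<phi> x y t * \<theta> x' y' (e t)) has_integral
      x * G 0 * \<theta> x' y' 0 + of_real \<kappa> * y * G (of_real s) * \<theta> x' y' (of_real s)) {0..1}"
    if "continuous_on (cball 0 1) G" "G holomorphic_on ball 0 1" for G x y x' y'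
  proof -
    let ?H = "\<lambda>z. G z * \<theta> x' y' z"
    have "\<theta> x' y' holomorphic_on ball 0 1"
      using \<theta>hol ball_subset_cball by (rule holomorphic_on_subset)
    then have H: "continuous_on (cball 0 1) ?H" "?H holomorphic_on ball 0 1"
      using \<theta>hol that
      by (auto intro!: continuous_on_mult holomorphic_on_mult intro: holomorphic_on_imp_continuous_on)
    have "((\<lambda>t. x * (?H (e t) * (e t / (e t - 0))) +
        of_real \<kappa> * y * (?H (e t) * (e t / (e t - of_real s)))) has_integral
        x * ?H 0 + of_real \<kappa> * y * ?H (of_real s)) {0..1}"
      unfolding e_def using s
      by (intro has_integral_add has_integral_mult_right has_integral_circle_Cauchy H) auto
    then show ?thesis
      using e0 by (simp add: \<phi>_def algebra_simps)
  qed
  have gram: "x * \<theta> x y 0 + of_real \<kappa> * y * \<theta> x y (of_real s) = of_real (gram_form \<kappa> x y)" for x y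
  proof -
    have "1 - s\<^sup>2 \<noteq> 0" using s by (simp add: power2_eq_1_iff)
    then have "1 - complex_of_real s * of_real s \<noteq> 0"
      by (metis of_real_1 of_real_diff of_real_eq_0_iff of_real_mult power2_eq_square)
    moreover have "complex_of_real \<kappa> * of_real \<kappa> = 1 - of_real s * of_real s"
      using \<kappa> by (metis of_real_1 of_real_diff of_real_mult power2_eq_square)
    ultimately have one: "of_real \<kappa> * (of_real \<kappa> / (1 - of_real s * of_real s)) = (1::complex)"
      by simp
    have "of_real \<kappa> * y * \<theta> x y (of_real s) = of_real \<kappa> * y * cnj x
        + y * cnj y * (of_real \<kappa> * (of_real \<kappa> / (1 - of_real s * of_real s)))"
      unfolding \<theta>_def by (simp add: distrib_left mult_ac)
    then have A: "of_real \<kappa> * y * \<theta> x y (of_real s) = of_real \<kappa> * y * cnj x + y * cnj y"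
      unfolding one by simp
    have B: "of_real (2 * Re (x * cnj y)) = x * cnj y + y * cnj x"
      by (simp add: complex_eq_iff algebra_simps)
    have C: "x * \<theta> x y 0 = x * cnj x + of_real \<kappa> * (x * cnj y)"
      by (simp add: \<theta>_def distrib_left mult_ac)
    have D: "of_real (gram_form \<kappa> x y) = x * cnj x + y * cnj y + of_real \<kappa> * of_real (2 * Re (x * cnj y))"
      unfolding gram_form_def of_real_add complex_norm_square by simp
    show ?thesis unfolding A C D B by (simp only: algebra_simps)
  qed
  have norm_int: "((\<lambda>t. (cmod (\<phi> x y t))\<^sup>2) has_integral gram_form \<kappa> x y) {0..1}" for x y
  proof -
    have "((\<lambda>t. Re (1 * \<phi> x y t * \<theta> x y (e t))) has_integral
        Re (x * 1 * \<theta> x y 0 + of_real \<kappa> * y * 1 * \<theta> x y (of_real s))) {0..1}"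
      using has_integral_linear[OF int[of "\<lambda>_. 1" x y x y] bounded_linear_Re] by (simp add: o_def)
    then show ?thesis
      by (simp add: gram \<theta>\<phi> complex_norm_square[symmetric])
  qed
  let ?\<phi> = "\<lambda>i. \<phi> (u i) (v i)" and ?\<psi> = "\<lambda>j. \<phi> (u' j) (v' j)" and ?\<theta> = "\<lambda>j. \<theta> (u' j) (v' j)"
  let ?P = "\<lambda>t. \<Sum>i\<in>X. (cmod (?\<phi> i t))\<^sup>2" and ?Q = "\<lambda>t. \<Sum>j\<in>X. (cmod (?\<psi> j t))\<^sup>2"
  have "((\<lambda>t. \<Sum>j\<in>X. \<Sum>i\<in>X. F i j (e t) * ?\<phi> i t * ?\<theta> j (e t)) has_integral
     (\<Sum>j\<in>X. \<Sum>i\<in>X. u i * F i j 0 * ?\<theta> j 0 + of_real \<kappa> * v i * F i j (of_real s) * ?\<theta> j (of_real s))) {0..1}"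
    by (intro has_integral_sum X int cont hol)
  also have "(\<Sum>j\<in>X. \<Sum>i\<in>X. u i * F i j 0 * ?\<theta> j 0 + of_real \<kappa> * v i * F i j (of_real s) * ?\<theta> j (of_real s))
     = (\<Sum>j\<in>X. u' j * ?\<theta> j 0 + of_real \<kappa> * v' j * ?\<theta> j (of_real s))"
    by (simp add: u'_def v'_def sum.distrib sum_distrib_left sum_distrib_right mult_ac)
  also have "\<dots> = of_real (\<Sum>j\<in>X. gram_form \<kappa> (u' j) (v' j))"
    by (simp add: gram)
  finally have J: "((\<lambda>t. \<Sum>j\<in>X. \<Sum>i\<in>X. F i j (e t) * ?\<phi> i t * ?\<theta> j (e t)) has_integral
      of_real (\<Sum>j\<in>X. gram_form \<kappa> (u' j) (v' j))) {0..1}" .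
  have H1: "((\<lambda>t. Re (\<Sum>j\<in>X. \<Sum>i\<in>X. F i j (e t) * ?\<phi> i t * ?\<theta> j (e t))) has_integral
      (\<Sum>j\<in>X. gram_form \<kappa> (u' j) (v' j))) {0..1}"
    using has_integral_linear[OF J bounded_linear_Re] by (simp only: o_def Re_complex_of_real)
  have H2: "((\<lambda>t. (M\<^sup>2 * ?P t + ?Q t) / 2) has_integral
      (M\<^sup>2 * (\<Sum>i\<in>X. gram_form \<kappa> (u i) (v i)) + (\<Sum>j\<in>X. gram_form \<kappa> (u' j) (v' j))) / 2) {0..1}"
    by (intro has_integral_divide has_integral_add has_integral_mult_right has_integral_sum X norm_int)
  have H3: "Re (\<Sum>j\<in>X. \<Sum>i\<in>X. F i j (e t) * ?\<phi> i t * ?\<theta> j (e t)) \<le> (M\<^sup>2 * ?P t + ?Q t) / 2" for t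
  proof -
    have sw: "(\<Sum>j\<in>X. \<Sum>i\<in>X. F i j (e t) * ?\<phi> i t * ?\<theta> j (e t))
        = (\<Sum>i\<in>X. ?\<phi> i t * (\<Sum>j\<in>X. F i j (e t) * ?\<theta> j (e t)))"
      by (subst sum.swap) (simp add: sum_distrib_left mult_ac)
    have "Re (\<Sum>j\<in>X. \<Sum>i\<in>X. F i j (e t) * ?\<phi> i t * ?\<theta> j (e t))
        \<le> M * (L2_set (\<lambda>i. cmod (?\<phi> i t)) X * L2_set (\<lambda>j. cmod (?\<theta> j (e t))) X)"
      unfolding sw by (rule order_trans[OF complex_Re_le_cmod bound]) (simp add: ne)
    also have "\<dots> = (M * L2_set (\<lambda>i. cmod (?\<phi> i t)) X) * L2_set (\<lambda>j. cmod (?\<psi> j t)) X"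
      by (simp add: \<theta>\<phi>)
    \<comment> \<open>A pointwise arithmetic-geometric mean inequality replaces Cauchy-Schwarz for
      integrals. The integral of \<open>?Q\<close> is the quantity to be bounded, so half of it is
      absorbed at the end.\<close>
    also have "\<dots> \<le> ((M * L2_set (\<lambda>i. cmod (?\<phi> i t)) X)\<^sup>2 + (L2_set (\<lambda>j. cmod (?\<psi> j t)) X)\<^sup>2) / 2"
    proof -
      have "x * y \<le> (x\<^sup>2 + y\<^sup>2) / 2" for x y :: real
        using sum_squares_bound[of x y] by (simp add: mult.assoc)
      then show ?thesis .
    qed
    also have "\<dots> = (M\<^sup>2 * ?P t + ?Q t) / 2"
      by (simp add: L2_set_def power_mult_distrib sum_nonneg)
    finally show ?thesis .
  qed
  have "(\<Sum>j\<in>X. gram_form \<kappa> (u' j) (v' j)) \<le>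
     (M\<^sup>2 * (\<Sum>i\<in>X. gram_form \<kappa> (u i) (v i)) + (\<Sum>j\<in>X. gram_form \<kappa> (u' j) (v' j))) / 2"
    by (rule has_integral_le[OF H1 H2 H3])
  then show ?thesis by simp
qed

section \<open>Discs through two points of a ball\<close>

lemma Cauchy_Schwarz_complex_sum:
  fixes f g :: "'i \<Rightarrow> complex"
  shows "(cmod (\<Sum>i\<in>X. f i * g i))\<^sup>2 \<le> (\<Sum>i\<in>X. (cmod (f i))\<^sup>2) * (\<Sum>i\<in>X. (cmod (g i))\<^sup>2)"
proof -
  have "cmod (\<Sum>i\<in>X. f i * g i) \<le> (\<Sum>i\<in>X. \<bar>cmod (f i)\<bar> * \<bar>cmod (g i)\<bar>)"
    by (rule order_trans[OF norm_sum]) (simp add: norm_mult)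
  also have "\<dots> \<le> L2_set (\<lambda>i. cmod (f i)) X * L2_set (\<lambda>i. cmod (g i)) X"
    by (rule L2_set_mult_ineq)
  finally have "(cmod (\<Sum>i\<in>X. f i * g i))\<^sup>2 \<le> (L2_set (\<lambda>i. cmod (f i)) X * L2_set (\<lambda>i. cmod (g i)) X)\<^sup>2"
    by (simp add: power_mono)
  then show ?thesis
    by (simp add: L2_set_def power_mult_distrib sum_nonneg)
qed

lemma cmod_add_square: "(cmod (x + y))\<^sup>2 = (cmod x)\<^sup>2 + (cmod y)\<^sup>2 + 2 * Re (x * cnj y)"
  unfolding cmod_power2 by (simp add: power2_eq_square algebra_simps)

text \<open>The disc is the linear fractional map z -> (a + z b) / (1 + z c), and the conclusions
  are stated with the denominator cleared. Passing through \<open>m\<close> at \<open>s\<close>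
  determines \<open>b\<close> from \<open>c\<close>.\<close>

lemma disc_through_two_points_of_ball:
  fixes a m :: "'i \<Rightarrow> complex" and s :: real
  assumes a: "(\<Sum>i\<in>X. (cmod (a i))\<^sup>2) < 1" and m: "(\<Sum>i\<in>X. (cmod (m i))\<^sup>2) < 1" and s: "0 < s"
    and le: "(1 - s\<^sup>2) * (cmod (1 - (\<Sum>i\<in>X. m i * cnj (a i))))\<^sup>2
      \<le> (1 - (\<Sum>i\<in>X. (cmod (a i))\<^sup>2)) * (1 - (\<Sum>i\<in>X. (cmod (m i))\<^sup>2))"
  obtains b c where "cmod c < 1" "\<And>i. a i + of_real s * b i = m i * (1 + of_real s * c)"
    "\<And>z. cmod z \<le> 1 \<Longrightarrow> (\<Sum>i\<in>X. (cmod (a i + z * b i))\<^sup>2) \<le> (cmod (1 + z * c))\<^sup>2"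
proof -
  define L where "L = (\<Sum>i\<in>X. (cmod (a i))\<^sup>2)"
  define K where "K = (\<Sum>i\<in>X. (cmod (m i))\<^sup>2)"
  define P where "P = (\<Sum>i\<in>X. m i * cnj (a i))"
  have LP: "(\<Sum>i\<in>X. a i * cnj (a i)) = of_real L"
    unfolding L_def of_real_sum complex_norm_square by simp
  have LK: "0 \<le> L" "0 \<le> K" "L < 1" "K < 1" using a m by (auto simp: L_def K_def sum_nonneg)
  have "(cmod P)\<^sup>2 \<le> K * L"
    using Cauchy_Schwarz_complex_sum[of m "\<lambda>i. cnj (a i)" X] by (simp add: P_def K_def L_def)
  also have "\<dots> < 1" using LK by (metis le_less_trans mult_left_le less_imp_le)
  finally have P: "P \<noteq> 1" by auto
  \<comment> \<open>This \<open>c\<close> makes the inner product of \<open>b\<close> with \<open>a\<close> equal to \<open>c\<close>, which cancels the terms linear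
    in \<open>z\<close> on the two sides of the required inequality.\<close>
  define c where "c = (P - of_real L) / (of_real s * (1 - P))"
  define b where "b i = c * m i + (m i - a i) / of_real s" for i
  define B where "B = (\<Sum>i\<in>X. (cmod (b i))\<^sup>2)"
  have sc: "1 + of_real s * c = (1 - of_real L) / (1 - P)"
    using P s by (simp add: c_def field_simps)
  have through: "a i + of_real s * b i = m i * (1 + of_real s * c)" for i
    using s by (simp add: b_def field_simps)
  have "(\<Sum>i\<in>X. b i * cnj (a i)) = (\<Sum>i\<in>X. c * (m i * cnj (a i)) + (m i * cnj (a i) - a i * cnj (a i)) / of_real s)"
    by (simp add: b_def algebra_simps diff_divide_distrib)
  also have "\<dots> = c * P + (P - of_real L) / of_real s"
    unfolding sum.distrib P_def LP[symmetric] by (simp add: sum_distrib_left sum_subtractf sum_divide_distrib diff_divide_distrib)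
  also have "\<dots> = c" using P s by (simp add: c_def field_simps)
  finally have ba: "(\<Sum>i\<in>X. b i * cnj (a i)) = c" .
  have expand: "(\<Sum>i\<in>X. (cmod (a i + z * b i))\<^sup>2) = L + (cmod z)\<^sup>2 * B + 2 * Re (z * c)" for z
  proof -
    have "(\<Sum>i\<in>X. (cmod (a i + z * b i))\<^sup>2)
        = (\<Sum>i\<in>X. (cmod (a i))\<^sup>2 + (cmod z)\<^sup>2 * (cmod (b i))\<^sup>2 + 2 * Re (z * (b i * cnj (a i))))"
      by (intro sum.cong refl) (simp add: cmod_add_square norm_mult power_mult_distrib algebra_simps)
    also have "\<dots> = L + (cmod z)\<^sup>2 * B + 2 * Re (z * (\<Sum>i\<in>X. b i * cnj (a i)))"
      by (simp add: sum.distrib L_def B_def sum_distrib_left)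
    finally show ?thesis by (simp add: ba)
  qed
  have expand1: "(cmod (1 + z * c))\<^sup>2 = 1 + (cmod z)\<^sup>2 * (cmod c)\<^sup>2 + 2 * Re (z * c)" for z
    by (simp add: cmod_add_square norm_mult power_mult_distrib)
  \<comment> \<open>At z = s the expansion is known twice, as the disc is at \<open>m\<close> there.
    This turns the hypothesis \<open>le\<close> into the bound \<open>B\<close> below, which
    controls the coefficient of |z|^2 for all z.\<close>
  have "(cmod (1 + of_real s * c))\<^sup>2 * K = (\<Sum>i\<in>X. (cmod (a i + of_real s * b i))\<^sup>2)"
    unfolding through K_def by (simp add: norm_mult power_mult_distrib sum_distrib_right mult_ac)
  then have "(cmod (1 + of_real s * c))\<^sup>2 * (1 - K) = (1 - L) - s\<^sup>2 * (B - (cmod c)\<^sup>2)"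
    unfolding expand using expand1[of "of_real s"] by (simp add: algebra_simps)
  moreover have "(1 - L) * (1 - s\<^sup>2) \<le> (cmod (1 + of_real s * c))\<^sup>2 * (1 - K)"
  proof -
    have "(1 - L) * ((1 - s\<^sup>2) * (cmod (1 - P))\<^sup>2) \<le> (1 - L) * ((1 - L) * (1 - K))"
      using le LK unfolding L_def[symmetric] K_def[symmetric] P_def[symmetric]
      by (intro mult_left_mono) auto
    then have "(1 - L) * (1 - s\<^sup>2) * (cmod (1 - P))\<^sup>2 \<le> (1 - L)\<^sup>2 * (1 - K)"
      by (simp add: power2_eq_square mult_ac)
    then have "(1 - L) * (1 - s\<^sup>2) \<le> (1 - L)\<^sup>2 * (1 - K) / (cmod (1 - P))\<^sup>2"
      using P by (simp add: pos_le_divide_eq)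
    moreover have "cmod (1 - of_real L) = 1 - L"
      using LK by (metis abs_of_nonneg diff_ge_0_iff_ge less_imp_le norm_of_real of_real_1 of_real_diff)
    ultimately show ?thesis
      unfolding sc by (simp add: norm_divide power_divide)
  qed
  ultimately have "s\<^sup>2 * (B - (cmod c)\<^sup>2) \<le> s\<^sup>2 * (1 - L)" by (simp add: algebra_simps)
  then have B: "B - (cmod c)\<^sup>2 \<le> 1 - L" using s by simp
  have c1: "cmod c < 1"
  proof -
    \<comment> \<open>Cauchy-Schwarz for \<open>c\<close> as the inner product of \<open>b\<close>
      and \<open>a\<close>; with the bound on \<open>B\<close> it gives |c|^2 <= L < 1, so the
      denominator has no zero in the closed disc.\<close>
    have "(cmod c)\<^sup>2 \<le> B * L"
      using Cauchy_Schwarz_complex_sum[of b "\<lambda>i. cnj (a i)" X] by (simp add: ba B_def L_def)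
    also have "\<dots> \<le> (1 - L + (cmod c)\<^sup>2) * L" using B LK by (intro mult_right_mono) auto
    finally have "(1 - L) * (cmod c)\<^sup>2 \<le> (1 - L) * L" by (simp add: algebra_simps)
    then have "(cmod c)\<^sup>2 < 1" using LK by simp
    then show ?thesis by (simp add: power_less_one_iff abs_square_less_1)
  qed
  show ?thesis
  proof (rule that[OF c1 through])
    fix z :: complex assume "cmod z \<le> 1"
    then have z: "(cmod z)\<^sup>2 \<le> 1" by (simp add: power_le_one)
    have "(cmod z)\<^sup>2 * (B - (cmod c)\<^sup>2) \<le> (cmod z)\<^sup>2 * (1 - L)" using B by (intro mult_left_mono) auto
    also have "\<dots> \<le> 1 * (1 - L)" using z LK by (intro mult_right_mono) auto
    finally show "(\<Sum>i\<in>X. (cmod (a i + z * b i))\<^sup>2) \<le> (cmod (1 + z * c))\<^sup>2"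
      unfolding expand expand1 by (simp add: algebra_simps)
  qed
qed

section \<open>The polyball\<close>

lemma continuous_on_poly_eval_comp:
  assumes "poly_in I f" "\<And>v. v \<in> I \<Longrightarrow> continuous_on S (\<lambda>x. g x v)"
  shows "continuous_on S (\<lambda>x. poly_eval f (g x))"
  unfolding poly_eval_def using assms by (intro continuous_intros) (auto simp: poly_in_def)

lemma holomorphic_on_poly_eval_comp:
  assumes "poly_in I f" "\<And>v. v \<in> I \<Longrightarrow> (\<lambda>x. g x v) holomorphic_on S"
  shows "(\<lambda>x. poly_eval f (g x)) holomorphic_on S"
  unfolding poly_eval_def using assms by (intro holomorphic_intros) (auto simp: poly_in_def)

text \<open>Off \<open>I\<close> the functions are fixed at \<open>undefined\<close>, so the set is
  a full product with singleton factors there and Tychonoff's theorem applies.\<close>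

lemma compact_PiE_cball:
  "compact (I \<rightarrow>\<^sub>E cball (0::complex) 1)"
proof -
  have "(I \<rightarrow>\<^sub>E cball (0::complex) 1) = (\<Pi>\<^sub>E i\<in>UNIV. if i \<in> I then cball 0 1 else {undefined})"
    by (fastforce simp: PiE_iff extensional_def split: if_splits)
  moreover have "compactin (product_topology (\<lambda>_. euclidean) UNIV)
      (\<Pi>\<^sub>E i\<in>UNIV. if i \<in> I then cball (0::complex) 1 else {undefined})"
    by (subst compactin_PiE) auto
  ultimately show ?thesis
    by (simp add: euclidean_product_topology)
qed

lemma closed_polyball_coordinate_le:
  assumes "z \<in> closed_polyball d n" "v \<in> polyball_index d n"
  shows "cmod (z v) \<le> 1"
proof -
  obtain r i where v: "v = (r, i)" "r \<in> {1..d}" "i \<in> {1..n r}"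
    using assms(2) by (auto simp: polyball_index_def)
  have "cmod (z (r, i)) \<le> L2_set (\<lambda>i. cmod (z (r, i))) {1..n r}"
    using v by (intro member_le_L2_set) auto
  then show ?thesis using assms(1) v by (force simp: closed_polyball_def)
qed

lemma compact_closed_polyball: "compact (closed_polyball d n)"
proof -
  let ?I = "polyball_index d n"
  let ?C = "{z :: nat \<times> nat \<Rightarrow> complex. \<forall>r\<in>{1..d}. L2_set (\<lambda>i. cmod (z (r, i))) {1..n r} \<le> 1}"
  have "closed ?C"
    unfolding L2_set_def Ball_def
    by (intro closed_Collect_all closed_Collect_imp closed_Collect_le open_Collect_const
        continuous_intros continuous_on_product_coordinates)
  then have "compact ((?I \<rightarrow>\<^sub>E cball 0 1) \<inter> ?C)"
    by (intro compact_Int_closed compact_PiE_cball)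
  also have "(?I \<rightarrow>\<^sub>E cball 0 1) \<inter> ?C = closed_polyball d n"
    using closed_polyball_coordinate_le[of _ d n] unfolding closed_polyball_def by (auto simp: PiE_iff extensional_def)
  finally show ?thesis .
qed

lemma closed_polyball_nonempty: "closed_polyball d n \<noteq> {}"
proof -
  have "(\<lambda>v\<in>polyball_index d n. 0) \<in> closed_polyball d n"
    by (auto simp: closed_polyball_def polyball_index_def L2_set_def)
  then show ?thesis by blast
qed

lemma continuous_on_rational:
  assumes "rational_on I K k p s" "i < k" "j < k"
  shows "continuous_on K (\<lambda>z. poly_eval (p i j) z / poly_eval (s i j) z)"
proof -
  have "continuous_on K (\<lambda>z. poly_eval f z)" if "poly_in I f" for f
    using that by (rule continuous_on_poly_eval_comp)
      (rule continuous_on_product_then_coordinatewise[OF continuous_on_id])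
  then show ?thesis
    using assms unfolding rational_on_def by (intro continuous_on_divide) auto
qed

section \<open>Norms of matrix-valued rational functions on the polyball\<close>

lemma block_norm_mult_le:
  fixes c :: "'i \<Rightarrow> 'i \<Rightarrow> complex"
  assumes "finite X"
  shows "block_norm X X (\<lambda>i j. (*) (c i j)) \<le> (\<Sum>i\<in>X. \<Sum>j\<in>X. cmod (c i j))"
proof -
  have "block_norm X X (\<lambda>i j. (*) (c i j)) \<le> (\<Sum>i\<in>X. \<Sum>j\<in>X. onorm ((*) (c i j)))"
    using assms by (intro block_norm_least L2_block_le_sum_onorm bounded_linear_mult_right)
  also have "\<dots> \<le> (\<Sum>i\<in>X. \<Sum>j\<in>X. cmod (c i j))"
    by (intro sum_mono onorm_le) (simp add: norm_mult)
  finally show ?thesis .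
qed

text \<open>This makes the supremum over the compact set meaningful. The block norm is dominated by
  the sum of the moduli of the entries, which is visibly continuous.\<close>

lemma bdd_above_block_norm_rational:
  assumes "rational_on I K k p s" "compact K"
  shows "bdd_above ((\<lambda>z. block_norm {..<k} {..<k}
    (\<lambda>i j. (*) (poly_eval (p i j) z / poly_eval (s i j) z))) ` K)"
proof -
  let ?f = "\<lambda>z. \<Sum>i<k. \<Sum>j<k. cmod (poly_eval (p i j) z / poly_eval (s i j) z)"
  have "compact (?f ` K)"
    using assms by (intro compact_continuous_image continuous_on_sum continuous_on_norm continuous_on_rational) auto
  then have "bdd_above (?f ` K)"
    by (intro bounded_imp_bdd_above compact_imp_bounded)
  then obtain B where B: "\<And>z. z \<in> K \<Longrightarrow> ?f z \<le> B"
    unfolding bdd_above_def by blast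
  show ?thesis
    by (intro bdd_aboveI2[of _ _ B] order_trans[OF block_norm_mult_le B]) auto
qed

lemma block_norm_bilinear_bound:
  fixes c :: "'i \<Rightarrow> 'i \<Rightarrow> complex"
  assumes "finite X" "block_norm X X (\<lambda>i j. (*) (c i j)) \<le> M"
  shows "cmod (\<Sum>i\<in>X. \<phi> i * (\<Sum>j\<in>X. c i j * \<psi> j))
    \<le> M * (L2_set (\<lambda>i. cmod (\<phi> i)) X * L2_set (\<lambda>j. cmod (\<psi> j)) X)"
proof -
  have "cmod (\<Sum>i\<in>X. \<phi> i * (\<Sum>j\<in>X. c i j * \<psi> j))
      \<le> (\<Sum>i\<in>X. \<bar>cmod (\<phi> i)\<bar> * \<bar>cmod (\<Sum>j\<in>X. c i j * \<psi> j)\<bar>)"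
    by (rule order_trans[OF norm_sum]) (simp add: norm_mult)
  also have "\<dots> \<le> L2_set (\<lambda>i. cmod (\<phi> i)) X * L2_set (\<lambda>i. cmod (\<Sum>j\<in>X. c i j * \<psi> j)) X"
    by (rule L2_set_mult_ineq)
  finally have 1: "cmod (\<Sum>i\<in>X. \<phi> i * (\<Sum>j\<in>X. c i j * \<psi> j)) \<le>
      L2_set (\<lambda>i. cmod (\<phi> i)) X * L2_set (\<lambda>i. cmod (\<Sum>j\<in>X. c i j * \<psi> j)) X" .
  have "L2_set (\<lambda>i. cmod (\<Sum>j\<in>X. c i j * \<psi> j)) X \<le>
      block_norm X X (\<lambda>i j. (*) (c i j)) * L2_set (\<lambda>j. cmod (\<psi> j)) X"
    using assms(1) by (intro block_norm_apply bounded_linear_mult_right)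
  also have "\<dots> \<le> M * L2_set (\<lambda>j. cmod (\<psi> j)) X"
    using assms(2) by (intro mult_right_mono) auto
  finally have "L2_set (\<lambda>i. cmod (\<phi> i)) X * L2_set (\<lambda>i. cmod (\<Sum>j\<in>X. c i j * \<psi> j)) X
      \<le> L2_set (\<lambda>i. cmod (\<phi> i)) X * (M * L2_set (\<lambda>j. cmod (\<psi> j)) X)"
    by (rule mult_left_mono) simp
  with 1 show ?thesis by (simp only: mult_ac)
qed

text \<open>Membership in the polyball is tested block by block, so the discs of all blocks, each at
  \<open>a\<close> for 0 and at \<open>m\<close> for the common parameter \<open>t\<close>, combine
  to one disc \<open>g\<close> in \<open>K\<close>. Composing the rational function with
  \<open>g\<close> leaves a problem in one variable.\<close>

lemma polyball_Pick:
  fixes d :: nat and n :: "nat \<Rightarrow> nat" and a m :: "nat \<times> nat \<Rightarrow> complex"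
  defines "I \<equiv> polyball_index d n" and "K \<equiv> closed_polyball d n"
  assumes rat: "rational_on I K k p s" and am: "a \<in> K" "m \<in> K"
    and \<gamma>: "0 \<le> \<gamma>" "\<gamma> < 1"
    and a1: "\<And>r. r \<in> {1..d} \<Longrightarrow> (\<Sum>i\<in>{1..n r}. (cmod (a (r, i)))\<^sup>2) < 1"
    and m1: "\<And>r. r \<in> {1..d} \<Longrightarrow> (\<Sum>i\<in>{1..n r}. (cmod (m (r, i)))\<^sup>2) < 1"
    and am1: "\<And>r. r \<in> {1..d} \<Longrightarrow> \<gamma>\<^sup>2 * (cmod (1 - (\<Sum>i\<in>{1..n r}. m (r, i) * cnj (a (r, i)))))\<^sup>2
      \<le> (1 - (\<Sum>i\<in>{1..n r}. (cmod (a (r, i)))\<^sup>2)) * (1 - (\<Sum>i\<in>{1..n r}. (cmod (m (r, i)))\<^sup>2))"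
  defines "q \<equiv> \<lambda>i j z. poly_eval (p i j) z / poly_eval (s i j) z"
  assumes M: "\<And>z. z \<in> K \<Longrightarrow> block_norm {..<k} {..<k} (\<lambda>i j. (*) (q i j z)) \<le> M"
  shows "(\<Sum>j<k. gram_form \<gamma> (\<Sum>i<k. q i j a * u i) (\<Sum>i<k. q i j m * v i))
    \<le> M\<^sup>2 * (\<Sum>i<k. gram_form \<gamma> (u i) (v i))"
proof (cases "\<gamma> = 0")
  case True
  \<comment> \<open>For \<open>\<gamma> = 0\<close> the second parameter would be 1, on the circle.
    But then the form has no cross term, and the claim splits into one inequality at
    \<open>a\<close> and one at \<open>m\<close>, each the Pick inequality for constant
    functions.\<close>
  have one: "(\<Sum>j<k. (cmod (\<Sum>i<k. q i j z * w i))\<^sup>2) \<le> M\<^sup>2 * (\<Sum>i<k. (cmod (w i))\<^sup>2)"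
    if "z \<in> K" for z w
    using two_point_Pick[of "{..<k}" "\<lambda>i j _. q i j z" M 0 1 w "\<lambda>_. 0"]
      block_norm_bilinear_bound[OF _ M[OF that]] by (simp add: gram_form_def)
  show ?thesis
    using one[OF am(1), of u] one[OF am(2), of v] True
    by (simp add: gram_form_def sum.distrib algebra_simps)
next
  case False
  define t where "t = sqrt (1 - \<gamma>\<^sup>2)"
  have g2: "0 < \<gamma>\<^sup>2" "\<gamma>\<^sup>2 < 1" using \<gamma> False by (auto simp: power_less_one_iff)
  have t2: "t\<^sup>2 = 1 - \<gamma>\<^sup>2" using g2 by (simp add: t_def)
  have t: "0 < t" "t < 1" using g2 by (auto simp: t_def real_sqrt_lt_1_iff)
  define P where "P r b c \<longleftrightarrow> cmod c < 1 \<and> (\<forall>i. a (r, i) + of_real t * b i = m (r, i) * (1 + of_real t * c)) \<and>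
    (\<forall>z. cmod z \<le> 1 \<longrightarrow> (\<Sum>i\<in>{1..n r}. (cmod (a (r, i) + z * b i))\<^sup>2) \<le> (cmod (1 + z * c))\<^sup>2)" for r b c
  have "\<exists>b c. P r b c" if "r \<in> {1..d}" for r
  proof -
    have "1 - t\<^sup>2 = \<gamma>\<^sup>2" using t2 by simp
    then have "(1 - t\<^sup>2) * (cmod (1 - (\<Sum>i\<in>{1..n r}. m (r, i) * cnj (a (r, i)))))\<^sup>2
      \<le> (1 - (\<Sum>i\<in>{1..n r}. (cmod (a (r, i)))\<^sup>2)) * (1 - (\<Sum>i\<in>{1..n r}. (cmod (m (r, i)))\<^sup>2))"
      using am1[OF that] by simp
    then show ?thesis
      by (rule disc_through_two_points_of_ball[OF a1[OF that] m1[OF that] t(1)]) (unfold P_def, blast)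
  qed
  then obtain b c where P: "\<And>r. r \<in> {1..d} \<Longrightarrow> P r (b r) (c r)" by metis
  then have c: "\<And>r. r \<in> {1..d} \<Longrightarrow> cmod (c r) < 1"
    and hit: "\<And>r i. r \<in> {1..d} \<Longrightarrow> a (r, i) + of_real t * b r i = m (r, i) * (1 + of_real t * c r)"
    and ball: "\<And>r z. r \<in> {1..d} \<Longrightarrow> cmod z \<le> 1 \<Longrightarrow>
       (\<Sum>i\<in>{1..n r}. (cmod (a (r, i) + z * b r i))\<^sup>2) \<le> (cmod (1 + z * c r))\<^sup>2"
    unfolding P_def by blast+
  define g where "g z = (\<lambda>(r, i)\<in>I. (a (r, i) + z * b r i) / (1 + z * c r))" for z
  have nz: "1 + z * c r \<noteq> 0" if "r \<in> {1..d}" "cmod z \<le> 1" for r z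
  proof
    assume "1 + z * c r = 0"
    then have "cmod (z * c r) = 1" by (metis add_eq_0_iff norm_minus_cancel norm_one)
    moreover have "cmod z * cmod (c r) \<le> 1 * cmod (c r)" using that by (intro mult_right_mono) auto
    ultimately show False using c[OF that(1)] by (simp add: norm_mult)
  qed
  have gI: "g z (r, i) = (a (r, i) + z * b r i) / (1 + z * c r)" if "r \<in> {1..d}" "i \<in> {1..n r}" for z r i
    using that by (simp add: g_def I_def polyball_index_def)
  have gK: "g z \<in> K" if z: "cmod z \<le> 1" for z
  proof -
    have "L2_set (\<lambda>i. cmod (g z (r, i))) {1..n r} \<le> 1" if r: "r \<in> {1..d}" for r
    proof -
      have "(\<Sum>i\<in>{1..n r}. (cmod (g z (r, i)))\<^sup>2)
          = (\<Sum>i\<in>{1..n r}. (cmod (a (r, i) + z * b r i))\<^sup>2) / (cmod (1 + z * c r))\<^sup>2"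
        unfolding sum_divide_distrib
        by (rule sum.cong[OF refl]) (simp only: gI[OF r] norm_divide power_divide)
      also have "\<dots> \<le> 1" using ball[OF r z] nz[OF r z] by (simp add: divide_le_eq)
      finally show ?thesis by (simp add: L2_set_def)
    qed
    then show ?thesis by (simp add: K_def closed_polyball_def g_def I_def[symmetric])
  qed
  \<comment> \<open>Equality of points as functions includes the value \<open>undefined\<close> off
    \<open>I\<close>, hence the case distinctions.\<close>
  have "g 0 v = a v" "g (of_real t) v = m v" for v
  proof -
    have "a \<in> I \<rightarrow>\<^sub>E UNIV" "m \<in> I \<rightarrow>\<^sub>E UNIV"
      using am by (simp_all add: K_def I_def closed_polyball_def)
    then have out: "a v = undefined" "m v = undefined" if "v \<notin> I"
      using that PiE_arb by fast+
    show "g 0 v = a v"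
    proof (cases "v \<in> I")
      case True
      then obtain r i where v: "v = (r, i)" "r \<in> {1..d}" "i \<in> {1..n r}"
        by (auto simp: I_def polyball_index_def)
      show ?thesis unfolding v(1) gI[OF v(2,3)] by simp
    qed (simp add: out g_def)
    show "g (of_real t) v = m v"
    proof (cases "v \<in> I")
      case True
      then obtain r i where v: "v = (r, i)" "r \<in> {1..d}" "i \<in> {1..n r}"
        by (auto simp: I_def polyball_index_def)
      show ?thesis using hit[OF v(2)] nz[OF v(2), of "of_real t"] t
        unfolding v(1) gI[OF v(2,3)] by simp
    qed (simp add: out g_def)
  qed
  then have g0: "g 0 = a" and gt: "g (of_real t) = m" by (auto simp: fun_eq_iff)
  have ghol: "(\<lambda>z. g z v) holomorphic_on cball 0 1" if "v \<in> I" for v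
  proof -
    obtain r i where v: "v = (r, i)" "r \<in> {1..d}" "i \<in> {1..n r}"
      using \<open>v \<in> I\<close> by (auto simp: I_def polyball_index_def)
    show ?thesis unfolding v(1) gI[OF v(2,3)] using nz[OF v(2)]
      by (intro holomorphic_intros) auto
  qed
  have qhol: "(\<lambda>z. q i j (g z)) holomorphic_on cball 0 1" if "i < k" "j < k" for i j
    unfolding q_def using rat that ghol gK unfolding rational_on_def
    by (intro holomorphic_on_divide holomorphic_on_poly_eval_comp[of I]) auto
  show ?thesis
    using two_point_Pick[of "{..<k}" "\<lambda>i j z. q i j (g z)" M t \<gamma> u v] t t2
      block_norm_bilinear_bound[OF _ M[OF gK]] qhol
    by (simp add: g0 gt holomorphic_on_imp_continuous_on holomorphic_on_subset[OF _ ball_subset_cball])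
qed

section \<open>Joint left eigenvectors in the plane\<close>

lemma norm_square_2: "(norm w)\<^sup>2 = (cmod (w $ 1))\<^sup>2 + (cmod (w $ 2))\<^sup>2" for w :: "complex ^ 2"
  by (simp add: norm_vec_def L2_set_def sum_2)

lemma norm_vector_smult_2: "norm (c *s w) = cmod c * norm w" for w :: "complex ^ 2"
proof (rule power2_eq_imp_eq)
  show "(norm (c *s w))\<^sup>2 = (cmod c * norm w)\<^sup>2"
    unfolding power_mult_distrib norm_square_2 by (simp add: norm_mult power_mult_distrib distrib_left)
qed auto

lemma norm_combination_gram_form:
  fixes p r :: "complex ^ 2"
  assumes "norm p = 1" "norm r = 1" "p $ 1 * cnj (r $ 1) + p $ 2 * cnj (r $ 2) = of_real \<gamma>"
  shows "(norm (u *s p + v *s r))\<^sup>2 = gram_form \<gamma> u v"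
proof -
  have "(norm (u *s p + v *s r))\<^sup>2 = (cmod u)\<^sup>2 * (norm p)\<^sup>2 + (cmod v)\<^sup>2 * (norm r)\<^sup>2
      + 2 * Re (u * cnj v * (p $ 1 * cnj (r $ 1) + p $ 2 * cnj (r $ 2)))"
    unfolding norm_square_2 by (simp add: cmod_add_square norm_mult power_mult_distrib algebra_simps)
  then show ?thesis unfolding assms by (simp add: gram_form_def)
qed

text \<open>A phase factor on the second vector makes the inner product real and nonnegative, so
  that the angle enters through a single number in [0, 1).\<close>

lemma normalized_eigenvectors_2:
  fixes p r :: "complex ^ 2"
  assumes ind: "p $ 1 * r $ 2 \<noteq> p $ 2 * r $ 1"
  obtains x y \<gamma> where "norm (x *s p) = 1" "norm (y *s r) = 1" "0 \<le> \<gamma>" "\<gamma> < 1"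
    "(x *s p) $ 1 * cnj ((y *s r) $ 1) + (x *s p) $ 2 * cnj ((y *s r) $ 2) = of_real \<gamma>"
    "(x *s p) $ 1 * (y *s r) $ 2 \<noteq> (x *s p) $ 2 * (y *s r) $ 1"
proof -
  have p0: "p \<noteq> 0" "r \<noteq> 0" using ind by auto
  define h where "h = p $ 1 * cnj (r $ 1) + p $ 2 * cnj (r $ 2)"
  define e where "e = (if h = 0 then 1 else h / of_real (cmod h))"
  have e: "cmod e = 1" "h * cnj e = of_real (cmod h)"
    by (auto simp: e_def norm_divide complex_norm_square[symmetric] power2_eq_square)
  define x where "x = (of_real (1 / norm p) :: complex)"
  define y where "y = of_real (1 / norm r) * e"
  define \<gamma> where "\<gamma> = cmod h / (norm p * norm r)"
  have xy0: "x \<noteq> 0" "y \<noteq> 0" using p0 e by (auto simp: x_def y_def)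
  have n1: "norm (x *s p) = 1" "norm (y *s r) = 1"
    using p0 e by (auto simp: norm_vector_smult_2 x_def y_def norm_mult norm_divide)
  have ip: "(x *s p) $ 1 * cnj ((y *s r) $ 1) + (x *s p) $ 2 * cnj ((y *s r) $ 2) = of_real \<gamma>"
  proof -
    have "(x *s p) $ 1 * cnj ((y *s r) $ 1) + (x *s p) $ 2 * cnj ((y *s r) $ 2)
       = of_real (1 / (norm p * norm r)) * (h * cnj e)"
      by (simp add: x_def y_def h_def algebra_simps add_divide_distrib)
    then show ?thesis by (simp add: e(2) \<gamma>_def)
  qed
  have ind': "(x *s p) $ 1 * (y *s r) $ 2 \<noteq> (x *s p) $ 2 * (y *s r) $ 1"
    using ind xy0 by (simp add: mult_ac)
  \<comment> \<open>Lagrange's identity: the defect in Cauchy-Schwarz is the squared modulus of the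
    determinant, positive by independence.\<close>
  have "(cmod h)\<^sup>2 + (cmod (p $ 1 * r $ 2 - p $ 2 * r $ 1))\<^sup>2 = (norm p)\<^sup>2 * (norm r)\<^sup>2"
    unfolding norm_square_2 h_def cmod_power2 by (simp add: power2_eq_square) algebra
  moreover have "(cmod (p $ 1 * r $ 2 - p $ 2 * r $ 1))\<^sup>2 > 0" using ind by simp
  ultimately have "(cmod h)\<^sup>2 < (norm p * norm r)\<^sup>2" unfolding power_mult_distrib by linarith
  then have "cmod h < norm p * norm r" by (rule power2_less_imp_less) simp
  then have "\<gamma> < 1" using p0 by (simp add: \<gamma>_def)
  then show ?thesis using that[OF n1 _ _ ip ind'] by (simp add: \<gamma>_def)
qed

text \<open>
  A bilinear pairing instead of the Hermitian one: its transposes are the left multiplications, so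
  that joint left eigenvectors occur with unconjugated eigenvalues.
\<close>

definition bidot :: "complex ^ 2 \<Rightarrow> complex ^ 2 \<Rightarrow> complex"
  where "bidot x y = x $ 1 * y $ 1 + x $ 2 * y $ 2"

lemma bidot_matrix: "bidot x (A *v y) = bidot (x v* A) y"
  by (simp add: bidot_def vector_matrix_2 matrix_vector_mult_def sum_2 algebra_simps)

lemma bidot_sum_right: "bidot x (\<Sum>i\<in>X. f i) = (\<Sum>i\<in>X. bidot x (f i))"
  by (simp add: bidot_def sum.distrib sum_distrib_left)

lemma bidot_sum_left: "bidot (\<Sum>i\<in>X. f i) x = (\<Sum>i\<in>X. bidot (f i) x)"
  by (simp add: bidot_def sum.distrib sum_distrib_right)

lemma bidot_le: "cmod (bidot x y) \<le> norm x * norm y"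
proof -
  have "(cmod (bidot x y))\<^sup>2 \<le> (norm x * norm y)\<^sup>2"
    using Cauchy_Schwarz_complex_sum[of "($) x" "($) y" UNIV]
    by (simp add: bidot_def sum_2 norm_square_2 power_mult_distrib)
  then show ?thesis by (rule power2_le_imp_le) simp
qed

definition cnj_vec :: "complex ^ 2 \<Rightarrow> complex ^ 2"
  where "cnj_vec x = (\<chi> i. cnj (x $ i))"

lemma norm_cnj_vec [simp]: "norm (cnj_vec x) = norm x"
  by (simp add: cnj_vec_def norm_vec_def)

lemma bidot_cnj: "bidot x (cnj_vec x) = of_real ((norm x)\<^sup>2)" "bidot (cnj_vec x) x = of_real ((norm x)\<^sup>2)"
  unfolding norm_square_2 of_real_add complex_norm_square
  by (simp_all add: bidot_def cnj_vec_def mult_ac)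

text \<open>The adjoint of the row has the same norm bound. It is obtained by testing the row on the
  conjugates of the vectors \<open>z v* S v\<close>.\<close>

lemma row_bound_left_mult:
  fixes S :: "'v \<Rightarrow> complex ^ 2 ^ 2"
  assumes row: "\<And>h. norm (\<Sum>v\<in>J. S v *v h v) \<le> \<sigma> * L2_set (\<lambda>v. norm (h v)) J"
  shows "(\<Sum>v\<in>J. (norm (z v* S v))\<^sup>2) \<le> \<sigma>\<^sup>2 * (norm z)\<^sup>2"
proof -
  define Y where "Y = L2_set (\<lambda>v. norm (z v* S v)) J"
  have Y2: "Y\<^sup>2 = (\<Sum>v\<in>J. (norm (z v* S v))\<^sup>2)" by (simp add: Y_def L2_set_def sum_nonneg)
  have eq: "of_real (Y\<^sup>2) = bidot z (\<Sum>v\<in>J. S v *v cnj_vec (z v* S v))"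
    unfolding Y2 by (simp add: bidot_sum_right bidot_matrix bidot_cnj)
  have "cmod (of_real (Y\<^sup>2)) \<le> norm z * norm (\<Sum>v\<in>J. S v *v cnj_vec (z v* S v))"
    unfolding eq by (rule bidot_le)
  then have "Y\<^sup>2 \<le> norm z * norm (\<Sum>v\<in>J. S v *v cnj_vec (z v* S v))"
    by (simp only: norm_of_real abs_power2)
  also have "\<dots> \<le> norm z * (\<sigma> * Y)"
    using row[of "\<lambda>v. cnj_vec (z v* S v)"] by (intro mult_left_mono) (auto simp: Y_def)
  finally have *: "Y * Y \<le> (\<sigma> * norm z) * Y" by (simp add: power2_eq_square mult_ac)
  have Y0: "0 \<le> Y" by (simp add: Y_def)
  show ?thesis
  proof (cases "Y = 0")
    case True
    then show ?thesis using Y2 by (metis zero_le_mult_iff zero_le_power2 zero_power2)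
  next
    case False
    then have "Y \<le> \<sigma> * norm z" using * Y0 by simp
    then have "Y\<^sup>2 \<le> (\<sigma> * norm z)\<^sup>2" using Y0 by (intro power_mono)
    then show ?thesis by (simp add: Y2 power_mult_distrib)
  qed
qed

text \<open>On combinations of \<open>p\<close> and \<open>r\<close> the adjoint bound becomes
  positivity of a Hermitian form with diagonal entries \<open>1 - ?L\<close>, \<open>1 - ?K\<close>
  and off-diagonal entry \<open>\<gamma>\<close> times \<open>E\<close>. The last conclusion is that
  its determinant is nonnegative.\<close>

lemma left_eigenvalues_row_bound:
  fixes S :: "'v \<Rightarrow> complex ^ 2 ^ 2"
  assumes row: "\<And>h. norm (\<Sum>v\<in>J. S v *v h v) \<le> \<sigma> * L2_set (\<lambda>v. norm (h v)) J"
    and "0 \<le> \<sigma>" "\<sigma> < 1"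
    and pr: "norm p = 1" "norm r = 1" "p $ 1 * cnj (r $ 1) + p $ 2 * cnj (r $ 2) = of_real \<gamma>"
    and eig: "\<And>v. v \<in> J \<Longrightarrow> p v* S v = a v *s p" "\<And>v. v \<in> J \<Longrightarrow> r v* S v = m v *s r"
  shows "(\<Sum>v\<in>J. (cmod (a v))\<^sup>2) < 1" (is "?L < 1") "(\<Sum>v\<in>J. (cmod (m v))\<^sup>2) < 1" (is "?K < 1")
    "\<gamma>\<^sup>2 * (cmod (1 - (\<Sum>v\<in>J. m v * cnj (a v))))\<^sup>2
      \<le> (1 - (\<Sum>v\<in>J. (cmod (a v))\<^sup>2)) * (1 - (\<Sum>v\<in>J. (cmod (m v))\<^sup>2))"
proof -
  have s1: "\<sigma>\<^sup>2 < 1" using assms(2,3) by (simp add: power_less_one_iff)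
  have main: "(\<Sum>v\<in>J. gram_form \<gamma> (u * a v) (w * m v)) \<le> \<sigma>\<^sup>2 * gram_form \<gamma> u w" for u w
  proof -
    have "(\<Sum>v\<in>J. (norm ((u *s p + w *s r) v* S v))\<^sup>2) = (\<Sum>v\<in>J. gram_form \<gamma> (u * a v) (w * m v))"
      using eig by (intro sum.cong refl) (simp add: vector_matrix_left_distrib scalar_vector_matrix_assoc
          vector_smult_assoc norm_combination_gram_form[OF pr])
    then show ?thesis
      using row_bound_left_mult[OF row, of "u *s p + w *s r"] by (simp add: norm_combination_gram_form[OF pr])
  qed
  show L: "?L < 1" using main[of 1 0] s1 by (simp add: gram_form_def)
  show "?K < 1" using main[of 0 1] s1 by (simp add: gram_form_def)
  define E where "E = 1 - (\<Sum>v\<in>J. a v * cnj (m v))"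
  have E: "cmod E = cmod (1 - (\<Sum>v\<in>J. m v * cnj (a v)))"
    by (subst complex_mod_cnj[symmetric]) (simp add: E_def mult_ac)
  have pos: "0 \<le> (cmod u)\<^sup>2 * (1 - ?L) + (cmod w)\<^sup>2 * (1 - ?K) + 2 * \<gamma> * Re (u * cnj w * E)" for u w
  proof -
    have "0 \<le> gram_form \<gamma> u w" by (metis norm_combination_gram_form[OF pr] zero_le_power2)
    then have "\<sigma>\<^sup>2 * gram_form \<gamma> u w \<le> 1 * gram_form \<gamma> u w" using s1 by (intro mult_right_mono) auto
    then have "(\<Sum>v\<in>J. gram_form \<gamma> (u * a v) (w * m v)) \<le> gram_form \<gamma> u w" using main[of u w] by simp
    moreover have "(\<Sum>v\<in>J. gram_form \<gamma> (u * a v) (w * m v)) = (\<Sum>v\<in>J. (cmod u)\<^sup>2 * (cmod (a v))\<^sup>2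
        + (cmod w)\<^sup>2 * (cmod (m v))\<^sup>2 + 2 * \<gamma> * Re (u * cnj w * (a v * cnj (m v))))"
      by (intro sum.cong refl) (simp add: gram_form_def norm_mult power_mult_distrib algebra_simps)
    moreover have "\<dots> = (cmod u)\<^sup>2 * ?L + (cmod w)\<^sup>2 * ?K + 2 * \<gamma> * Re (u * cnj w * (1 - E))"
      unfolding E_def by (simp only: sum.distrib sum_distrib_left diff_diff_eq2 Re_sum add_diff_cancel_left')
    moreover have "Re (u * cnj w * (1 - E)) = Re (u * cnj w) - Re (u * cnj w * E)"
      by (simp add: right_diff_distrib)
    ultimately show ?thesis by (simp add: gram_form_def algebra_simps)
  qed
  \<comment> \<open>The form at u = - \<open>\<gamma>\<close> times the conjugate of
    \<open>E\<close>, w = 1 - \<open>?L\<close> equals 1 - \<open>?L\<close> times the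
    determinant.\<close>
  have "0 \<le> \<gamma>\<^sup>2 * (cmod E)\<^sup>2 * (1 - ?L) + (1 - ?L)\<^sup>2 * (1 - ?K) - 2 * \<gamma>\<^sup>2 * (cmod E)\<^sup>2 * (1 - ?L)"
  proof -
    have "cmod (of_real (1 - ?L)) = 1 - ?L" using L by (simp only: norm_of_real)
    moreover have "Re (- (of_real \<gamma> * cnj E) * cnj (of_real (1 - ?L)) * E) = - (\<gamma> * (cmod E)\<^sup>2 * (1 - ?L))"
    proof -
      have "- (of_real \<gamma> * cnj E) * cnj (of_real x) * E = of_real (- (\<gamma> * (cmod E)\<^sup>2 * x))" for x
        unfolding of_real_mult of_real_minus complex_norm_square by (simp add: mult_ac)
      then show ?thesis by (simp only: Re_complex_of_real)
    qed
    moreover have "cmod (- (of_real \<gamma> * cnj E)) ^ 2 = \<gamma>\<^sup>2 * (cmod E)\<^sup>2"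
      by (simp add: norm_mult power_mult_distrib)
    ultimately show ?thesis
      using pos[of "- (of_real \<gamma> * cnj E)" "of_real (1 - ?L)"]
      by (simp only: mult_minus_right mult_ac power2_eq_square)
  qed
  then have "0 \<le> (1 - ?L) * ((1 - ?L) * (1 - ?K) - \<gamma>\<^sup>2 * (cmod E)\<^sup>2)"
    by (simp add: power2_eq_square algebra_simps)
  then show "\<gamma>\<^sup>2 * (cmod (1 - (\<Sum>v\<in>J. m v * cnj (a v))))\<^sup>2 \<le> (1 - ?L) * (1 - ?K)"
    using L by (simp add: zero_le_mult_iff E)
qed

text \<open>The assumption on \<open>gram_form\<close> bounds the action of the block matrix on row
  vectors, written in the basis \<open>p\<close>, \<open>r\<close>. Duality carries the bound over
  to column vectors.\<close>

lemma block_bound_from_gram_form: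
  fixes Q :: "'i \<Rightarrow> 'i \<Rightarrow> complex ^ 2 ^ 2"
  assumes pr: "norm p = 1" "norm r = 1" "p $ 1 * cnj (r $ 1) + p $ 2 * cnj (r $ 2) = of_real \<gamma>"
    and ind: "p $ 1 * r $ 2 \<noteq> p $ 2 * r $ 1"
    and eig: "\<And>i j. i \<in> X \<Longrightarrow> j \<in> X \<Longrightarrow> p v* Q i j = a i j *s p"
      "\<And>i j. i \<in> X \<Longrightarrow> j \<in> X \<Longrightarrow> r v* Q i j = m i j *s r"
    and M: "0 \<le> M" "\<And>u v. (\<Sum>j\<in>X. gram_form \<gamma> (\<Sum>i\<in>X. a i j * u i) (\<Sum>i\<in>X. m i j * v i))
      \<le> M\<^sup>2 * (\<Sum>i\<in>X. gram_form \<gamma> (u i) (v i))"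
  shows "L2_set (\<lambda>i. norm (\<Sum>j\<in>X. Q i j *v h j)) X \<le> M * L2_set (\<lambda>j. norm (h j)) X"
proof -
  define g where "g i = (\<Sum>j\<in>X. Q i j *v h j)" for i
  define D where "D = p $ 1 * r $ 2 - p $ 2 * r $ 1"
  have D: "D \<noteq> 0" using ind by (simp add: D_def)
  \<comment> \<open>Cramer's rule.\<close>
  have basis: "w = ((w $ 1 * r $ 2 - w $ 2 * r $ 1) / D) *s p + ((p $ 1 * w $ 2 - p $ 2 * w $ 1) / D) *s r" for w
    using D by (simp add: vec_eq_iff forall_2 field_simps) (simp add: D_def algebra_simps)
  define u v where "u i = (cnj_vec (g i) $ 1 * r $ 2 - cnj_vec (g i) $ 2 * r $ 1) / D"
    and "v i = (p $ 1 * cnj_vec (g i) $ 2 - p $ 2 * cnj_vec (g i) $ 1) / D" for i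
  have uv: "cnj_vec (g i) = u i *s p + v i *s r" for i
    unfolding u_def v_def by (rule basis)
  define w where "w j = (\<Sum>i\<in>X. a i j * u i) *s p + (\<Sum>i\<in>X. m i j * v i) *s r" for j
  define G where "G = L2_set (\<lambda>i. norm (g i)) X"
  define W where "W = L2_set (\<lambda>j. norm (w j)) X"
  have G2: "G\<^sup>2 = (\<Sum>i\<in>X. gram_form \<gamma> (u i) (v i))"
    unfolding norm_combination_gram_form[OF pr, symmetric] uv[symmetric]
    by (simp add: G_def L2_set_def sum_nonneg)
  have W2: "W\<^sup>2 \<le> M\<^sup>2 * G\<^sup>2"
    using M(2)[of u v] unfolding G2 norm_combination_gram_form[OF pr, symmetric]
    by (simp add: W_def L2_set_def sum_nonneg w_def)
  have WM: "W \<le> M * G"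
  proof (rule power2_le_imp_le)
    show "W\<^sup>2 \<le> (M * G)\<^sup>2" using W2 by (simp only: power_mult_distrib)
    show "0 \<le> M * G" by (simp add: G_def M(1))
  qed
  have wj: "w j = (\<Sum>i\<in>X. cnj_vec (g i) v* Q i j)" if "j \<in> X" for j
    using that unfolding uv w_def
    by (simp add: vector_matrix_left_distrib scalar_vector_matrix_assoc eig vector_smult_assoc
        vec_eq_iff sum.distrib sum_distrib_left sum_distrib_right mult_ac)
  \<comment> \<open>The squared norm of the image of \<open>h\<close> is rewritten by moving the
    blocks to the left factor; there the bound \<open>WM\<close> applies, and one factor
    \<open>G\<close> cancels.\<close>
  have "of_real (G\<^sup>2) = (\<Sum>i\<in>X. bidot (cnj_vec (g i)) (g i))"
    by (simp add: bidot_cnj G_def L2_set_def sum_nonneg)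
  also have "\<dots> = (\<Sum>i\<in>X. \<Sum>j\<in>X. bidot (cnj_vec (g i) v* Q i j) (h j))"
    by (intro sum.cong refl) (subst (2) g_def, simp add: bidot_sum_right bidot_matrix)
  also have "\<dots> = (\<Sum>j\<in>X. bidot (w j) (h j))"
    by (subst sum.swap) (simp add: wj bidot_sum_left)
  finally have eq: "of_real (G\<^sup>2) = (\<Sum>j\<in>X. bidot (w j) (h j))" .
  have "G\<^sup>2 = cmod (\<Sum>j\<in>X. bidot (w j) (h j))"
    unfolding eq[symmetric] by (simp only: norm_of_real abs_power2)
  also have "\<dots> \<le> (\<Sum>j\<in>X. \<bar>norm (w j)\<bar> * \<bar>norm (h j)\<bar>)"
    by (rule order_trans[OF norm_sum]) (simp add: bidot_le sum_mono)
  also have "\<dots> \<le> W * L2_set (\<lambda>j. norm (h j)) X"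
    unfolding W_def by (rule L2_set_mult_ineq)
  also have "\<dots> \<le> M * G * L2_set (\<lambda>j. norm (h j)) X"
    using WM by (intro mult_right_mono) auto
  finally have *: "G * G \<le> (M * L2_set (\<lambda>j. norm (h j)) X) * G" by (simp add: power2_eq_square mult_ac)
  have "0 \<le> G" by (simp add: G_def)
  then have "G \<le> M * L2_set (\<lambda>j. norm (h j)) X"
    using * M(1) by (cases "G = 0") auto
  then show ?thesis by (simp add: G_def g_def)
qed

section \<open>Diagonalizable tuples\<close>

text \<open>The second conclusion serves the passage to the limit: a lower bound for |f| on
  \<open>K\<close> bounds the determinant of \<open>poly_mat f S\<close> below, uniformly in
  \<open>S\<close>.\<close>

lemma rational_bound_diagonalizable:
  fixes d :: nat and n :: "nat \<Rightarrow> nat" and S :: "nat \<times> nat \<Rightarrow> complex ^ 2 ^ 2"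
  defines "I \<equiv> polyball_index d n" and "K \<equiv> closed_polyball d n"
  assumes rat: "rational_on I K k p s" and comm: "commuting_tuple I S"
    and row: "\<And>r h. r \<in> {1..d} \<Longrightarrow> norm (\<Sum>i\<in>{1..n r}. S (r, i) *v h i) \<le> \<sigma> * L2_set (\<lambda>i. norm (h i)) {1..n r}"
    and \<sigma>: "0 \<le> \<sigma>" "\<sigma> < 1"
    and ind: "x $ 1 * y $ 2 \<noteq> x $ 2 * y $ 1"
    and eig: "\<And>v. v \<in> I \<Longrightarrow> x v* S v = a v *s x" "\<And>v. v \<in> I \<Longrightarrow> y v* S v = m v *s y"
    and M: "0 \<le> M" "\<And>z. z \<in> K \<Longrightarrow> block_norm {..<k} {..<k}
      (\<lambda>i j. (*) (poly_eval (p i j) z / poly_eval (s i j) z)) \<le> M"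
  shows "L2_set (\<lambda>i. norm (\<Sum>j<k. (poly_mat (p i j) S ** matrix_inv (poly_mat (s i j) S)) *v h j)) {..<k}
      \<le> M * L2_set (\<lambda>j. norm (h j)) {..<k}" (is ?bound)
    and "\<And>f. poly_in I f \<Longrightarrow> \<exists>z\<in>K. \<exists>w\<in>K. det (poly_mat f S) = poly_eval f z * poly_eval f w"
proof -
  obtain c e \<gamma> where nr: "norm (c *s x) = 1" "norm (e *s y) = 1" "0 \<le> \<gamma>" "\<gamma> < 1"
    "(c *s x) $ 1 * cnj ((e *s y) $ 1) + (c *s x) $ 2 * cnj ((e *s y) $ 2) = of_real \<gamma>"
    "(c *s x) $ 1 * (e *s y) $ 2 \<noteq> (c *s x) $ 2 * (e *s y) $ 1"
    by (rule normalized_eigenvectors_2[OF ind])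
  define P R where "P = c *s x" and "R = e *s y"
  note nr = nr[folded P_def R_def]
  \<comment> \<open>Points of \<open>K\<close> are extensional functions, so the eigenvalues are
    restricted to \<open>I\<close>.\<close>
  define a' m' where "a' = restrict a I" and "m' = restrict m I"
  have eigP: "P v* S v = a' v *s P" and eigR: "R v* S v = m' v *s R" if "v \<in> I" for v
    using that eig unfolding P_def R_def a'_def m'_def
    by (simp_all add: scalar_vector_matrix_assoc vector_smult_assoc mult.commute)
  have inI: "(r, i) \<in> I" if "r \<in> {1..d}" "i \<in> {1..n r}" for r i
    using that by (simp add: I_def polyball_index_def)
  note rb = left_eigenvalues_row_bound[OF row \<sigma> nr(1,2,5) eigP eigR, OF _ inI inI]
  have a1: "(\<Sum>i\<in>{1..n r}. (cmod (a' (r, i)))\<^sup>2) < 1" if "r \<in> {1..d}" for r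
    by (rule rb(1)) (use that in auto)
  have m1: "(\<Sum>i\<in>{1..n r}. (cmod (m' (r, i)))\<^sup>2) < 1" if "r \<in> {1..d}" for r
    by (rule rb(2)) (use that in auto)
  have am1: "\<gamma>\<^sup>2 * (cmod (1 - (\<Sum>i\<in>{1..n r}. m' (r, i) * cnj (a' (r, i)))))\<^sup>2
      \<le> (1 - (\<Sum>i\<in>{1..n r}. (cmod (a' (r, i)))\<^sup>2)) * (1 - (\<Sum>i\<in>{1..n r}. (cmod (m' (r, i)))\<^sup>2))"
    if "r \<in> {1..d}" for r
    by (rule rb(3)) (use that in auto)
  have aK: "a' \<in> K" "m' \<in> K"
    unfolding K_def closed_polyball_def L2_set_def
    using a1 m1 by (auto simp: a'_def m'_def I_def intro: less_imp_le)
  have polyP: "P v* poly_mat f S = poly_eval f a' *s P" and polyR: "R v* poly_mat f S = poly_eval f m' *s R"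
    if "poly_in I f" for f
    using left_eigen_poly_mat[OF comm that] eigP eigR by blast+
  have det: "det (poly_mat f S) = poly_eval f a' * poly_eval f m'" if "poly_in I f" for f
    by (rule det_left_eigen_2[OF polyP[OF that] polyR[OF that] nr(6)])
  then show "\<exists>z\<in>K. \<exists>w\<in>K. det (poly_mat f S) = poly_eval f z * poly_eval f w" if "poly_in I f" for f
    using aK that by blast
  let ?Q = "\<lambda>i j. poly_mat (p i j) S ** matrix_inv (poly_mat (s i j) S)"
  let ?q = "\<lambda>i j z. poly_eval (p i j) z / poly_eval (s i j) z"
  have eigQ: "P v* ?Q i j = ?q i j a' *s P" "R v* ?Q i j = ?q i j m' *s R"
    if "i \<in> {..<k}" "j \<in> {..<k}" for i j
  proof -
    have pin: "poly_in I (p i j)" "poly_in I (s i j)"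
      and nz: "poly_eval (s i j) a' \<noteq> 0" "poly_eval (s i j) m' \<noteq> 0"
      using rat that aK by (auto simp: rational_on_def)
    have D: "det (poly_mat (s i j) S) \<noteq> 0" using det[OF pin(2)] nz by simp
    show "P v* ?Q i j = ?q i j a' *s P" "R v* ?Q i j = ?q i j m' *s R"
      by (simp_all add: vector_matrix_mul_assoc[symmetric] polyP[OF pin(1)] polyR[OF pin(1)]
          scalar_vector_matrix_assoc vector_smult_assoc
          left_eigen_matrix_inv[OF polyP[OF pin(2)] nz(1) D]
          left_eigen_matrix_inv[OF polyR[OF pin(2)] nz(2) D])
  qed
  show ?bound
    by (rule block_bound_from_gram_form[OF nr(1,2,5,6) eigQ M(1)
      polyball_Pick[OF rat[unfolded I_def K_def] aK[unfolded K_def] nr(3,4) a1 m1 am1 M(2)[unfolded K_def]]])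
qed

section \<open>Approximation by diagonalizable strict row contractions\<close>

text \<open>With x the difference of the diagonal entries and y four times the product of the
  off-diagonal entries of a matrix, these are the shifts of its upper left entry that produce a
  double eigenvalue.\<close>

lemma finite_shifted_square_roots: "finite {\<epsilon>::real. (of_real \<epsilon> + x)\<^sup>2 + y = (0::complex)}"
proof (rule finite_subset)
  show "{\<epsilon>::real. (of_real \<epsilon> + x)\<^sup>2 + y = 0} \<subseteq> Re ` {csqrt (- y) - x, - csqrt (- y) - x}"
  proof
    fix \<epsilon> :: real assume "\<epsilon> \<in> {\<epsilon>::real. (of_real \<epsilon> + x)\<^sup>2 + y = 0}"
    then have "(of_real \<epsilon> + x)\<^sup>2 = (csqrt (- y))\<^sup>2" by (simp add: add_eq_0_iff2)
    then have "of_real \<epsilon> + x = csqrt (- y) \<or> of_real \<epsilon> + x = - csqrt (- y)"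
      unfolding power2_eq_iff .
    then have "of_real \<epsilon> \<in> {csqrt (- y) - x, - csqrt (- y) - x}"
      by (auto simp: algebra_simps)
    then show "\<epsilon> \<in> Re ` {csqrt (- y) - x, - csqrt (- y) - x}"
      by (metis Re_complex_of_real imageI)
  qed
qed simp

lemma eventually_at_right_notin_finite:
  assumes "finite (Z::real set)"
  shows "eventually (\<lambda>\<epsilon>. \<epsilon> \<notin> Z) (at_right 0)"
proof -
  have "eventually (\<lambda>\<epsilon>. \<epsilon> \<in> - (Z - {0})) (nhds 0)"
    using assms by (intro eventually_nhds_in_open open_Compl finite_imp_closed) auto
  then have "eventually (\<lambda>\<epsilon>. \<epsilon> \<in> - (Z - {0})) (at_right 0)"
    using filter_leD[OF at_within_le_nhds] by blast
  then show ?thesis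
    using eventually_at_right_less[of 0] by eventually_elim auto
qed

text \<open>Moving the common matrix \<open>B\<close>, instead of the members of the tuple
  separately, keeps the tuple commuting.\<close>

lemma commuting_tuple_affine:
  fixes B :: "complex ^ 2 ^ 2"
  shows "commuting_tuple I (\<lambda>v. mat t ** (mat (\<alpha> v) + mat (\<beta> v) ** B))"
  by (simp add: commuting_tuple_def matrix_eq_2 matrix_mul_2) (simp add: algebra_simps)

lemma tendsto_mat:
  assumes "(f \<longlongrightarrow> l) F"
  shows "((\<lambda>x. mat (f x) :: complex ^ 'n ^ 'n) \<longlongrightarrow> mat l) F"
  unfolding mat_def by (intro tendsto_vec_lambda) (simp add: assms)

lemma tendsto_matrix_vector_mul:
  fixes A :: "'x \<Rightarrow> complex ^ 'n ^ 'm"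
  assumes "(A \<longlongrightarrow> a) F"
  shows "((\<lambda>x. A x *v h) \<longlongrightarrow> a *v h) F"
  unfolding matrix_vector_mult_def by (intro tendsto_intros assms)

text \<open>
  Adding \<open>\<epsilon>\<close> times this matrix to a matrix makes the eigenvalues distinct for all but at most two \<open>\<epsilon>\<close>,
  since the discriminant becomes a monic quadratic polynomial in \<open>\<epsilon>\<close>.
\<close>

definition corner :: "complex ^ 2 ^ 2"
  where "corner = vector [vector [1, 0], vector [0, 0]]"

lemma corner_entries [simp]:
  "corner $ 1 $ 1 = 1" "corner $ 1 $ 2 = 0" "corner $ 2 $ 1 = 0" "corner $ 2 $ 2 = 0"
  by (simp_all add: corner_def)

lemma matrix_vector_mult_2: "(A *v x) $ i = A $ i $ 1 * x $ 1 + A $ i $ 2 * x $ 2"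
  for A :: "complex ^ 2 ^ 2"
  by (simp add: matrix_vector_mult_def sum_2)

lemma norm_corner_le: "norm (corner *v x) \<le> norm x"
  by (rule power2_le_imp_le) (simp_all add: norm_square_2 matrix_vector_mult_2)

text \<open>The perturbation adds at most \<open>\<epsilon> * (C - 1)\<close> to the norm of the
  row. The divisor \<open>1 + \<epsilon> * C\<close> exceeds the resulting bound by
  \<open>\<epsilon>\<close>, which makes the contraction strict.\<close>

lemma row_bound_perturbed:
  fixes T :: "'v \<Rightarrow> complex ^ 2 ^ 2"
  assumes J: "finite J" and row: "row_contraction J T" and "\<epsilon> > 0" and C: "(\<Sum>v\<in>J. cmod (\<beta> v)) \<le> C - 1"
  shows "norm (\<Sum>v\<in>J. (mat (of_real (1 / (1 + \<epsilon> * C))) ** (T v + mat (of_real \<epsilon> * \<beta> v) ** corner)) *v h v)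
    \<le> (1 + \<epsilon> * (C - 1)) / (1 + \<epsilon> * C) * L2_set (\<lambda>v. norm (h v)) J"
proof -
  let ?L = "L2_set (\<lambda>v. norm (h v)) J"
  have C1: "1 \<le> C" using C by (metis diff_ge_0_iff_ge norm_ge_zero order_trans sum_nonneg)
  then have den: "0 < 1 + \<epsilon> * C" using \<open>\<epsilon> > 0\<close> by (simp add: add_pos_pos)
  have "(\<Sum>v\<in>J. (mat (of_real (1 / (1 + \<epsilon> * C))) ** (T v + mat (of_real \<epsilon> * \<beta> v) ** corner)) *v h v)
      = of_real (1 / (1 + \<epsilon> * C)) *s ((\<Sum>v\<in>J. T v *v h v) + (\<Sum>v\<in>J. (of_real \<epsilon> * \<beta> v) *s (corner *v h v)))"
    unfolding sum.distrib[symmetric]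
    by (simp add: vec_eq_iff forall_2 matrix_vector_mult_2 matrix_mul_2 sum_distrib_left algebra_simps
        del: of_real_divide of_real_add of_real_mult)
  then have "norm (\<Sum>v\<in>J. (mat (of_real (1 / (1 + \<epsilon> * C))) ** (T v + mat (of_real \<epsilon> * \<beta> v) ** corner)) *v h v)
      = (1 / (1 + \<epsilon> * C)) * norm ((\<Sum>v\<in>J. T v *v h v) + (\<Sum>v\<in>J. (of_real \<epsilon> * \<beta> v) *s (corner *v h v)))"
    using den by (simp only: norm_vector_smult_2 norm_of_real) simp
  also have "\<dots> \<le> (1 / (1 + \<epsilon> * C)) * (?L + \<epsilon> * (C - 1) * ?L)"
  proof (intro mult_left_mono order_trans[OF norm_triangle_ineq] add_mono)
    show "norm (\<Sum>v\<in>J. T v *v h v) \<le> ?L" using row_contraction_apply[OF J row] .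
    have "norm (\<Sum>v\<in>J. (of_real \<epsilon> * \<beta> v) *s (corner *v h v)) \<le> (\<Sum>v\<in>J. \<epsilon> * cmod (\<beta> v) * ?L)"
    proof (rule order_trans[OF norm_sum], rule sum_mono)
      fix v assume v: "v \<in> J"
      have "norm (corner *v h v) \<le> ?L"
        using norm_corner_le[of "h v"] member_le_L2_set[OF J v, of "\<lambda>v. norm (h v)"] by linarith
      then show "norm ((of_real \<epsilon> * \<beta> v) *s (corner *v h v)) \<le> \<epsilon> * cmod (\<beta> v) * ?L"
        unfolding norm_vector_smult_2 norm_mult norm_of_real using \<open>\<epsilon> > 0\<close>
        by (intro mult_mono) auto
    qed
    also have "\<dots> = \<epsilon> * (\<Sum>v\<in>J. cmod (\<beta> v)) * ?L"
      by (simp add: sum_distrib_left sum_distrib_right)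
    also have "\<dots> \<le> \<epsilon> * (C - 1) * ?L"
      using C \<open>\<epsilon> > 0\<close> by (intro mult_right_mono mult_left_mono) auto
    finally show "norm (\<Sum>v\<in>J. (of_real \<epsilon> * \<beta> v) *s (corner *v h v)) \<le> \<epsilon> * (C - 1) * ?L" .
  qed (use den in auto)
  also have "\<dots> = (1 + \<epsilon> * (C - 1)) / (1 + \<epsilon> * C) * ?L"
    by (simp add: distrib_right)
  finally show ?thesis .
qed

text \<open>Testing the row on the vectors \<open>cnj (l v) *s x\<close> gives L^2 <= L for the
  Euclidean norm L of the eigenvalues.\<close>

lemma joint_eigenvalue_bound:
  fixes T :: "'v \<Rightarrow> complex ^ 2 ^ 2"
  assumes J: "finite J" and row: "row_contraction J T" and "x \<noteq> 0" and eig: "\<And>v. v \<in> J \<Longrightarrow> T v *v x = l v *s x"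
  shows "L2_set (\<lambda>v. cmod (l v)) J \<le> 1"
proof -
  let ?L = "L2_set (\<lambda>v. cmod (l v)) J"
  have sq: "(\<Sum>v\<in>J. l v * cnj (l v)) = of_real (?L\<^sup>2)"
  proof -
    have "?L\<^sup>2 = (\<Sum>v\<in>J. (cmod (l v))\<^sup>2)" by (simp add: L2_set_def sum_nonneg)
    then show ?thesis by (simp only: of_real_sum complex_norm_square)
  qed
  have "(\<Sum>v\<in>J. T v *v (cnj (l v) *s x)) = (\<Sum>v\<in>J. (l v * cnj (l v)) *s x)"
    using eig by (intro sum.cong refl) (simp add: vec.linear_scale[OF matrix_vector_mul_linear_gen] vector_smult_assoc mult.commute)
  also have "\<dots> = of_real (?L\<^sup>2) *s x"
    unfolding sq[symmetric] by (simp add: vec_eq_iff sum_distrib_right)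
  finally have "?L\<^sup>2 * norm x = norm (\<Sum>v\<in>J. T v *v (cnj (l v) *s x))"
    by (simp only: norm_vector_smult_2 norm_of_real abs_power2)
  also have "\<dots> \<le> L2_set (\<lambda>v. norm (cnj (l v) *s x)) J" by (rule row_contraction_apply[OF J row])
  also have "\<dots> = ?L * norm x"
    unfolding norm_vector_smult_2 complex_mod_cnj by (rule L2_set_left_distrib[symmetric]) simp
  finally have "?L * ?L * norm x \<le> ?L * norm x" by (simp only: power2_eq_square)
  then have LL: "?L * ?L \<le> 1 * ?L"
    using \<open>x \<noteq> 0\<close> by (simp only: mult_le_cancel_right mult_1_left) (simp add: not_less)
  show ?thesis
  proof (cases "?L = 0")
    case False
    moreover have "0 \<le> ?L" by simp
    ultimately have "0 < ?L" by linarith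
    then show ?thesis using LL by (rule mult_right_le_imp_le[rotated])
  qed simp
qed

lemma block_norm_mult_nonneg:
  fixes c :: "nat \<Rightarrow> nat \<Rightarrow> complex"
  assumes "k > 0"
  shows "0 \<le> block_norm {..<k} {..<k} (\<lambda>i j. (*) (c i j))"
proof -
  let ?x = "\<lambda>j::nat. if j = 0 then 1 else (0::complex)"
  have "L2_set (\<lambda>j. norm (?x j)) {..<k} = 1"
  proof -
    have "(\<Sum>j<k. (norm (?x j))\<^sup>2) = (\<Sum>j<k. if j = 0 then 1 else 0)"
      by (intro sum.cong) auto
    then show ?thesis using assms by (simp add: L2_set_def)
  qed
  then have "L2_set (\<lambda>i. norm (\<Sum>j<k. c i j * ?x j)) {..<k} \<le> block_norm {..<k} {..<k} (\<lambda>i j. (*) (c i j))"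
    using block_norm_apply[of "{..<k}" "{..<k}" "\<lambda>i j. (*) (c i j)" ?x] by (simp add: bounded_linear_mult_right)
  then show ?thesis by (rule order_trans[OF L2_set_nonneg])
qed

theorem mainTheorem6:
  fixes d :: nat and n :: "nat \<Rightarrow> nat" and T :: "nat \<Rightarrow> nat \<Rightarrow> complex ^ 2 ^ 2"
  assumes "d > 0" and "\<And>r. r \<in> {1..d} \<Longrightarrow> n r > 0"
    and "\<And>r. r \<in> {1..d} \<Longrightarrow> commuting_tuple {1..n r} (T r)"
    and "\<And>r. r \<in> {1..d} \<Longrightarrow> row_contraction {1..n r} (T r)"
    and "\<And>r s i j. \<lbrakk>r \<in> {1..d}; s \<in> {1..d}; r \<noteq> s; i \<in> {1..n r}; j \<in> {1..n s}\<rbrakk>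
           \<Longrightarrow> T r i ** T s j = T s j ** T r i"
  shows "complete_spectral_set (polyball_index d n) (closed_polyball d n) (\<lambda>(r, i). T r i)"
proof -
  define I where "I = polyball_index d n"
  define K where "K = closed_polyball d n"
  define T' where "T' = (\<lambda>(r, i). T r i)"
  have T'[simp]: "T' (r, i) = T r i" for r i by (simp add: T'_def)
  have finI: "finite I" by (simp add: I_def polyball_index_def)
  have comm: "commuting_tuple I T'"
    unfolding commuting_tuple_def
  proof (intro ballI)
    fix u v assume "u \<in> I" "v \<in> I"
    then obtain r i s j where "u = (r, i)" "v = (s, j)" "r \<in> {1..d}" "s \<in> {1..d}" "i \<in> {1..n r}" "j \<in> {1..n s}"
      unfolding I_def polyball_index_def by blast
    then show "T' u ** T' v = T' v ** T' u"
      using assms(3,5) unfolding commuting_tuple_def by (cases "r = s") auto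
  qed
  have spec: "joint_spectrum I T' \<subseteq> K"
  proof
    fix l assume "l \<in> joint_spectrum I T'"
    then obtain x where l: "l \<in> I \<rightarrow>\<^sub>E UNIV" "x \<noteq> 0" "\<And>v. v \<in> I \<Longrightarrow> T' v *v x = l v *s x"
      by (auto simp: joint_spectrum_def)
    have "L2_set (\<lambda>i. cmod (l (r, i))) {1..n r} \<le> 1" if r: "r \<in> {1..d}" for r
    proof (rule joint_eigenvalue_bound[OF _ assms(4)[OF r] l(2)])
      fix i assume "i \<in> {1..n r}"
      then have "(r, i) \<in> I" using r by (simp add: I_def polyball_index_def)
      from l(3)[OF this] show "T r i *v x = l (r, i) *s x" by simp
    qed simp
    then show "l \<in> K" using l(1) by (simp add: K_def closed_polyball_def I_def)
  qed
  obtain A \<alpha> \<beta> where A: "\<And>v. v \<in> I \<Longrightarrow> T' v = mat (\<alpha> v) + mat (\<beta> v) ** A"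
    by (rule commuting_tuple_2_span[OF comm]) (rule that)
  \<comment> \<open>The sum runs over all blocks, so one scaling factor works for each of them; the
    summand 1 provides the strictness.\<close>
  define C where "C = 1 + (\<Sum>v\<in>I. cmod (\<beta> v))"
  have C1: "1 \<le> C" by (simp add: C_def sum_nonneg)
  define t where "t \<epsilon> = complex_of_real (1 / (1 + \<epsilon> * C))" for \<epsilon> :: real
  define S where "S \<epsilon> v = mat (t \<epsilon>) ** (mat (\<alpha> v) + mat (\<beta> v) ** (A + mat (of_real \<epsilon>) ** corner))"
    for \<epsilon> :: real and v
  have Scomm: "commuting_tuple I (S \<epsilon>)" for \<epsilon>
    unfolding S_def by (rule commuting_tuple_affine)
  have t_lim: "(t \<longlongrightarrow> 1) (at_right 0)"
    unfolding t_def by (rule tendsto_eq_intros refl | simp)+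
  have S_lim: "((\<lambda>\<epsilon>. S \<epsilon> v) \<longlongrightarrow> T' v) (at_right 0)" if "v \<in> I" for v
  proof -
    have "((\<lambda>\<epsilon>. S \<epsilon> v) \<longlongrightarrow> mat 1 ** (mat (\<alpha> v) + mat (\<beta> v) ** (A + mat (of_real 0) ** corner))) (at_right 0)"
      unfolding S_def by (intro tendsto_matrix_mul tendsto_mat t_lim tendsto_add tendsto_const
          tendsto_of_real tendsto_ident_at)
    then show ?thesis by (simp add: A[OF that])
  qed
  have S_T: "S \<epsilon> v = mat (t \<epsilon>) ** (T' v + mat (of_real \<epsilon> * \<beta> v) ** corner)" if "v \<in> I" for \<epsilon> v
    unfolding S_def A[OF that] by (simp add: matrix_eq_2 matrix_mul_2 algebra_simps)
  have S_row: "norm (\<Sum>i\<in>{1..n r}. S \<epsilon> (r, i) *v h i)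
      \<le> (1 + \<epsilon> * (C - 1)) / (1 + \<epsilon> * C) * L2_set (\<lambda>i. norm (h i)) {1..n r}"
    if r: "r \<in> {1..d}" and "\<epsilon> > 0" for \<epsilon> r h
  proof -
    have "(\<Sum>i\<in>{1..n r}. cmod (\<beta> (r, i))) = (\<Sum>v\<in>Pair r ` {1..n r}. cmod (\<beta> v))"
      by (subst sum.reindex) (auto simp: inj_on_def)
    also have "\<dots> \<le> C - 1"
      unfolding C_def using r finI by (auto intro!: sum_mono2 simp: I_def polyball_index_def)
    finally have "(\<Sum>i\<in>{1..n r}. cmod (\<beta> (r, i))) \<le> C - 1" .
    note row_bound_perturbed[OF _ assms(4)[OF r] \<open>\<epsilon> > 0\<close> this, of h]
    moreover have "S \<epsilon> (r, i) = mat (t \<epsilon>) ** (T r i + mat (of_real \<epsilon> * \<beta> (r, i)) ** corner)"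
      if "i \<in> {1..n r}" for i
      using S_T[of "(r, i)" \<epsilon>] r that by (simp add: I_def polyball_index_def)
    ultimately show ?thesis by (simp add: t_def)
  qed
  have ev: "eventually (\<lambda>\<epsilon>. \<epsilon> > 0 \<and> ((A + mat (of_real \<epsilon>) ** corner) $ 1 $ 1 - (A + mat (of_real \<epsilon>) ** corner) $ 2 $ 2)\<^sup>2
      + 4 * (A + mat (of_real \<epsilon>) ** corner) $ 1 $ 2 * (A + mat (of_real \<epsilon>) ** corner) $ 2 $ 1 \<noteq> 0) (at_right 0)"
    using eventually_at_right_less[of 0]
      eventually_at_right_notin_finite[OF finite_shifted_square_roots[of "A $ 1 $ 1 - A $ 2 $ 2" "4 * A $ 1 $ 2 * A $ 2 $ 1"]]
    by eventually_elim (simp add: matrix_mul_2 algebra_simps)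
  have main: "block_norm {..<k} {..<k} (\<lambda>i j. (*v) (poly_mat (p i j) T' ** matrix_inv (poly_mat (s i j) T')))
      \<le> (SUP z\<in>K. block_norm {..<k} {..<k} (\<lambda>i j. (*) (poly_eval (p i j) z / poly_eval (s i j) z)))"
    (is "_ \<le> ?M") if k: "k > 0" and rat: "rational_on I K k p s" for k p s
  proof -
    let ?b = "\<lambda>z. block_norm {..<k} {..<k} (\<lambda>i j. (*) (poly_eval (p i j) z / poly_eval (s i j) z))"
    have bdd: "bdd_above (?b ` K)"
      using rat compact_closed_polyball unfolding K_def by (rule bdd_above_block_norm_rational)
    have M: "?b z \<le> ?M" if "z \<in> K" for z
      using that bdd by (rule cSUP_upper)
    obtain z0 where "z0 \<in> K" using closed_polyball_nonempty[of d n] by (auto simp: K_def)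
    then have M0: "0 \<le> ?M"
      using M[of z0] block_norm_mult_nonneg[OF k] by (meson order_trans)
    have approx: "eventually (\<lambda>\<epsilon>. (\<forall>h. L2_set (\<lambda>i. norm (\<Sum>j<k. (poly_mat (p i j) (S \<epsilon>)
          ** matrix_inv (poly_mat (s i j) (S \<epsilon>))) *v h j)) {..<k} \<le> ?M * L2_set (\<lambda>j. norm (h j)) {..<k})
        \<and> (\<forall>f. poly_in I f \<longrightarrow> (\<exists>z\<in>K. \<exists>w\<in>K. det (poly_mat f (S \<epsilon>)) = poly_eval f z * poly_eval f w))) (at_right 0)"
      using ev
    proof eventually_elim
      case (elim \<epsilon>)
      then have \<epsilon>: "\<epsilon> > 0" by blast
      obtain x y a b where xy: "x v* (A + mat (of_real \<epsilon>) ** corner) = a *s x"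
        "y v* (A + mat (of_real \<epsilon>) ** corner) = b *s y" "x $ 1 * y $ 2 \<noteq> x $ 2 * y $ 1"
        by (rule distinct_left_eigenvectors_2[OF conjunct2[OF elim]])
      have eig: "w v* S \<epsilon> v = (t \<epsilon> * (\<alpha> v + \<beta> v * c)) *s w"
        if "w v* (A + mat (of_real \<epsilon>) ** corner) = c *s w" for w c v
      proof -
        have "w v* S \<epsilon> v = t \<epsilon> *s (\<alpha> v *s w + \<beta> v *s (w v* (A + mat (of_real \<epsilon>) ** corner)))"
          unfolding S_def vector_matrix_mul_assoc[symmetric] vector_matrix_mult_add_rdistrib[of w "mat (\<alpha> v)"]
            vector_matrix_mat scalar_vector_matrix_assoc ..
        then show ?thesis unfolding that by (simp add: vec_eq_iff algebra_simps)
      qed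
      have "0 \<le> \<epsilon> * (C - 1)" "0 < 1 + \<epsilon> * C" using \<epsilon> C1 by (simp_all add: add_pos_pos)
      then have \<sigma>: "0 \<le> (1 + \<epsilon> * (C - 1)) / (1 + \<epsilon> * C)" "(1 + \<epsilon> * (C - 1)) / (1 + \<epsilon> * C) < 1"
        using \<epsilon> by (simp add: divide_nonneg_pos, simp add: algebra_simps)
      note rb = rational_bound_diagonalizable[OF rat[unfolded I_def K_def] Scomm[unfolded I_def] S_row[OF _ \<epsilon>] \<sigma>
          xy(3) eig[OF xy(1)] eig[OF xy(2)] M0[unfolded K_def] M[unfolded K_def]]
      show ?case
        using rb unfolding I_def[symmetric] K_def[symmetric] by blast
    qed
    \<comment> \<open>The minimum \<open>\<delta>\<close> of the modulus of the denominator on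
      \<open>K\<close> is positive. Each approximant has determinant of modulus at least
      \<open>\<delta> * \<delta>\<close>, and this survives the limit.\<close>
    have det: "det (poly_mat (s i j) T') \<noteq> 0" if "i < k" "j < k" for i j
    proof -
      have pin: "poly_in I (s i j)" and nz: "\<And>z. z \<in> K \<Longrightarrow> poly_eval (s i j) z \<noteq> 0"
        using rat that by (auto simp: rational_on_def)
      have "continuous_on K (\<lambda>z. cmod (poly_eval (s i j) z))"
        by (intro continuous_on_norm continuous_on_poly_eval_comp[OF pin]
            continuous_on_product_then_coordinatewise[OF continuous_on_id])
      then obtain z1 where z1: "z1 \<in> K" "\<And>z. z \<in> K \<Longrightarrow> cmod (poly_eval (s i j) z1) \<le> cmod (poly_eval (s i j) z)"
        using continuous_attains_inf[of K] compact_closed_polyball closed_polyball_nonempty unfolding K_def by metis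
      define \<delta> where "\<delta> = cmod (poly_eval (s i j) z1)"
      have \<delta>: "\<delta> > 0" using nz[OF z1(1)] by (simp add: \<delta>_def)
      have "eventually (\<lambda>\<epsilon>. \<delta> * \<delta> \<le> cmod (det (poly_mat (s i j) (S \<epsilon>)))) (at_right 0)"
        using approx
      proof eventually_elim
        case (elim \<epsilon>)
        then obtain z w where zw: "z \<in> K" "w \<in> K"
          "det (poly_mat (s i j) (S \<epsilon>)) = poly_eval (s i j) z * poly_eval (s i j) w" using pin by blast
        show ?case
          unfolding zw(3) norm_mult using z1(2)[OF zw(1)] z1(2)[OF zw(2)] \<delta>
          by (intro mult_mono) (auto simp: \<delta>_def)
      qed
      moreover have "((\<lambda>\<epsilon>. cmod (det (poly_mat (s i j) (S \<epsilon>)))) \<longlongrightarrow> cmod (det (poly_mat (s i j) T'))) (at_right 0)"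
        unfolding det_2 by (intro tendsto_intros tendsto_poly_mat[OF Scomm comm S_lim pin])
      ultimately have "\<delta> * \<delta> \<le> cmod (det (poly_mat (s i j) T'))"
        by (intro tendsto_lowerbound) auto
      moreover have "0 < \<delta> * \<delta>" using \<delta> by simp
      ultimately show ?thesis by auto
    qed
    have lim: "((\<lambda>\<epsilon>. poly_mat (p i j) (S \<epsilon>) ** matrix_inv (poly_mat (s i j) (S \<epsilon>))) \<longlongrightarrow>
        poly_mat (p i j) T' ** matrix_inv (poly_mat (s i j) T')) (at_right 0)" if "i < k" "j < k" for i j
    proof -
      have "poly_in I (p i j)" "poly_in I (s i j)"
        using rat that by (auto simp: rational_on_def)
      then show ?thesis
        by (intro tendsto_matrix_mul tendsto_matrix_inv_2 det[OF that] tendsto_poly_mat[OF Scomm comm S_lim])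
    qed
    \<comment> \<open>The limit is taken for each fixed vector \<open>h\<close>, where convergence
      of finitely many matrices suffices.\<close>
    show ?thesis
    proof (rule block_norm_least)
      fix h :: "nat \<Rightarrow> complex ^ 2" assume h: "L2_set (\<lambda>j. norm (h j)) {..<k} \<le> 1"
      let ?N = "\<lambda>V. L2_set (\<lambda>i. norm (\<Sum>j<k. (poly_mat (p i j) V ** matrix_inv (poly_mat (s i j) V)) *v h j)) {..<k}"
      have "((\<lambda>\<epsilon>. ?N (S \<epsilon>)) \<longlongrightarrow> ?N T') (at_right 0)"
        unfolding L2_set_def
        by (intro tendsto_real_sqrt tendsto_sum tendsto_power tendsto_norm tendsto_matrix_vector_mul lim) auto
      moreover have "eventually (\<lambda>\<epsilon>. ?N (S \<epsilon>) \<le> ?M * L2_set (\<lambda>j. norm (h j)) {..<k}) (at_right 0)"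
        using approx by eventually_elim blast
      ultimately have "?N T' \<le> ?M * L2_set (\<lambda>j. norm (h j)) {..<k}"
        by (intro tendsto_upperbound) auto
      also have "\<dots> \<le> ?M * 1" using h M0 by (intro mult_left_mono)
      finally show "?N T' \<le> ?M" by simp
    qed
  qed
  have KI: "K \<subseteq> I \<rightarrow>\<^sub>E UNIV" by (auto simp: K_def I_def closed_polyball_def)
  have cK: "compact K" unfolding K_def by (rule compact_closed_polyball)
  have "complete_spectral_set I K T'"
    unfolding complete_spectral_set_def using comm KI cK spec main by simp
  then show ?thesis by (simp add: I_def K_def T'_def)
qed

end
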